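(* Let $Q$ be the infinitesimal generator of an ergodic regular-jump Markov chain on $\mathbb F$ that is block-tridiagonal (an LD-QBD generator): $Q(k;k+1)=A_k(1)$ and $Q(k;k)=A_k(0)$ for $k\in\mathbb Z_+$, $Q(k;k-1)=A_k(-1)$ for $k\in\mathbb N$, and $Q(k;\ell)=O$ if $|k-\ell|\ge2$. Let $\pi$ be its stationary distribution. Suppose that (i) $Q$ is irreducible and its LC-block-augmented truncation ${}_{(n)}Q$ has a single communicating class in $\mathbb F_n$ for each $n\in\mathbb N$; and (ii) there exist $b>0$, $c>0$, $K\in\mathbb Z_+$ and a column vector $v\ge e/c$ on $\mathbb F$ such that $$Qv\le -c\,v+b\,1_{\mathbb F_K}.$$ Let ${}_{(n)}\pi$ be the stationary distribution of ${}_{(n)}Q$. Let $\beta>0$ and fix any $N\in\{K,K+1,\dots\}$ such that $O<[\Phi^{(\beta)}_{\mathbb F_N}]_{\mathbb F_K}\le[\Phi^{(\beta)}]_{\mathbb F_K}$. Then for all $n\in\mathbb N$, $$\sup_{e\le g\le cv}\frac{|\pi-{}_{(n)}\pi|\,g}{\pi g}\le 2\,{}_{(n)}\pi(n)A_n(1)\left[v(n)+v(n+1)+2b\left(\frac1c+\frac{2}{\beta\,\overline\phi^{(\beta)}_{K,N}}\right)e\right].$$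
   Context: Notation: $\mathbb Z_+=\{0,1,2,\dots\}$, $\mathbb N=\{1,2,\dots\}$. For $k\in\mathbb Z_+$, $\mathbb S_k=\{0,1,\dots,S_k\}$ with $S_k\in\mathbb Z_+$, and $S_k=S_1$ for all $k\in\mathbb N$. Levels: $\mathbb L_k=\{k\}\times\mathbb S_k$; $\mathbb F=\bigcup_{k\ge0}\mathbb L_k$, $\mathbb F_n=\bigcup_{k=0}^n\mathbb L_k$. For a vector $x=(x(k,i))_{(k,i)\in\mathbb F}$, $x(k)=(x(k,i))_{i\in\mathbb S_k}$ is its subvector for level $k$. $e$ is a column vector of ones of appropriate size, $1_{\mathbb C}$ is the column indicator vector of $\mathbb C\subseteq\mathbb F$, $O$ the zero matrix; inequalities and absolute values $|\cdot|$ of vectors and matrices are entrywise. The Markov chain is a continuous-time regular-jump (non-explosive) chain with state space $\mathbb F$, transition matrix function $P^{(t)}=(p^{(t)}(k,i;\ell,j))$ and stable, conservative infinitesimal generator $Q=(q(k,i;\ell,j))$ with blocks $Q(k;\ell)=(q(k,i;\ell,j))_{i\in\mathbb S_k,\,j\in\mathbb S_\ell}$. Ergodic means irreducible and positive recurrent; $\pi$ is the unique stationary distribution (row vector, $\pi Q=0$, $\pi e=1$). For $n\in\mathbb N$, the last-column-block-augmented (LC-block-augmented) truncation ${}_{(n)}Q$ of $Q$ is the conservative $q$-matrix on $\mathbb F$ with blocks $${}_{(n)}Q(k;\ell)=\begin{cases}Q(k;\ell),&k\in\mathbb Z_+,\ 0\le\ell\le n-1,\\ Q(k;n)+\sum_{m>n,\,m\ne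 k}Q(k;m),&k\in\mathbb Z_+,\ \ell=n,\\ Q(k;k),&k=\ell\ge n+1,\\ O,&\text{otherwise.}\end{cases}$$ ${}_{(n)}\pi=({}_{(n)}\pi(k,i))_{(k,i)\in\mathbb F}$ is its unique stationary distribution (row vector); ${}_{(n)}\pi(k)=0$ for $k\ge n+1$. For $\beta>0$: $\Phi^{(\beta)}=\int_0^\infty\beta e^{-\beta t}P^{(t)}\,dt$. For $N\ge K$, $Q_{\mathbb F_N}=(q(k,i;\ell,j))_{(k,i),(\ell,j)\in\mathbb F_N}$ is the northwest-corner truncation of $Q$, and $\Phi^{(\beta)}_{\mathbb F_N}=(\phi^{(\beta)}_{\mathbb F_N}(k,i;\ell,j))=\int_0^\infty\beta e^{-\beta t}\exp\{Q_{\mathbb F_N}t\}\,dt=(I-Q_{\mathbb F_N}/\beta)^{-1}$. $[\,\cdot\,]_{\mathbb F_K}$ denotes the $|\mathbb F_K|\times|\mathbb F_K|$ northwest corner of a matrix (rows and columns in $\mathbb F_K$). Finally $\overline\phi^{(\beta)}_{K,N}=\sup_{(\ell,j)\in\mathbb F_N}\min_{(k,i)\in\mathbb F_K}\phi^{(\beta)}_{\mathbb F_N}(k,i;\ell,j)$. *)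

theory Defs
  imports "HOL-Probability.Probability"
begin

section \<open>State space\<close>

type_synonym state = "nat \<times> nat"

definition state_space :: "(nat \<Rightarrow> nat) \<Rightarrow> state set" where
  "state_space S = {(k, i). i \<le> S k}"

definition levels_upto :: "(nat \<Rightarrow> nat) \<Rightarrow> nat \<Rightarrow> state set" where
  "levels_upto S n = {(k, i). k \<le> n \<and> i \<le> S k}"

section \<open>Regular-jump Markov chains\<close>

text \<open>
  A chain is given by one measure \<open>M x\<close> per initial state \<open>x\<close>, under which the process
  \<open>X\<close> starts in \<open>x\<close>. Only times \<open>t \<ge> 0\<close> matter.
\<close>

definition trans_prob ::
  "(state \<Rightarrow> 'w measure) \<Rightarrow> (real \<Rightarrow> 'w \<Rightarrow> state) \<Rightarrow> real \<Rightarrow> state \<Rightarrow> state \<Rightarrow> real" where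
  "trans_prob M X t x y = measure (M x) {w \<in> space (M x). X t w = y}"

text \<open>
  The last clause is the Markov property together with time-homogeneity, multiplied out so that
  no conditioning on null events occurs: \<open>T\<close> is a finite set of times before the present \<open>s\<close>,
  and \<open>h\<close> the observed history.
\<close>

definition markov_chain ::
  "state set \<Rightarrow> (state \<Rightarrow> 'w measure) \<Rightarrow> (real \<Rightarrow> 'w \<Rightarrow> state) \<Rightarrow> bool" where
  "markov_chain E M X \<longleftrightarrow>
     (\<forall>x\<in>E. prob_space (M x)
        \<and> (\<forall>t\<ge>0. X t \<in> measurable (M x) (count_space E))
        \<and> (AE w in M x. X 0 w = x)
        \<and> (\<forall>s\<ge>0. \<forall>t\<ge>0. \<forall>T h. \<forall>y\<in>E. \<forall>z\<in>E. finite T \<and> T \<subseteq> {0..s} \<longrightarrow>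
             measure (M x) {w \<in> space (M x). (\<forall>r\<in>T. X r w = h r) \<and> X s w = y \<and> X (s + t) w = z}
             = measure (M x) {w \<in> space (M x). (\<forall>r\<in>T. X r w = h r) \<and> X s w = y}
               * trans_prob M X t y z))"

text \<open>
  The topology of \<open>state\<close> is discrete, so right-continuity says that the path stays in its
  current state for a positive time. Finitely many discontinuities in bounded intervals
  excludes explosion.
\<close>

definition regular_jump_path :: "(real \<Rightarrow> state) \<Rightarrow> bool" where
  "regular_jump_path f \<longleftrightarrow>
     (\<forall>t\<ge>0. continuous (at_right t) f)
     \<and> (\<forall>u\<ge>0. finite {t \<in> {0..u}. \<not> continuous (at t within {0..}) f})"

definition regular_jump_chain ::
  "state set \<Rightarrow> (state \<Rightarrow> 'w measure) \<Rightarrow> (real \<Rightarrow> 'w \<Rightarrow> state) \<Rightarrow> bool" where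
  "regular_jump_chain E M X \<longleftrightarrow>
     markov_chain E M X \<and> (\<forall>x\<in>E. AE w in M x. regular_jump_path (\<lambda>t. X t w))"

text \<open>Stability of the generator is implicit: the derivatives at \<open>0\<close> are finite reals.\<close>

definition is_generator ::
  "state set \<Rightarrow> (state \<Rightarrow> 'w measure) \<Rightarrow> (real \<Rightarrow> 'w \<Rightarrow> state) \<Rightarrow> (state \<Rightarrow> state \<Rightarrow> real) \<Rightarrow> bool" where
  "is_generator E M X Q \<longleftrightarrow>
     (\<forall>x\<in>E. \<forall>y\<in>E.
        ((\<lambda>t. (trans_prob M X t x y - of_bool (x = y)) / t) \<longlongrightarrow> Q x y) (at_right 0))"

definition conservative :: "state set \<Rightarrow> (state \<Rightarrow> state \<Rightarrow> real) \<Rightarrow> bool" where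
  "conservative E Q \<longleftrightarrow> (\<forall>x\<in>E. (Q x has_sum 0) E)"

text \<open>The time of the first visit to \<open>x\<close> after having left \<open>x\<close>; \<open>\<infinity>\<close> if there is none.\<close>

definition return_time :: "(real \<Rightarrow> 'w \<Rightarrow> state) \<Rightarrow> state \<Rightarrow> 'w \<Rightarrow> ennreal" where
  "return_time X x w =
     (INF t\<in>{t. t \<ge> 0 \<and> X t w = x \<and> (\<exists>s\<in>{0..t}. X s w \<noteq> x)}. ennreal t)"

definition ergodic_chain ::
  "state set \<Rightarrow> (state \<Rightarrow> 'w measure) \<Rightarrow> (real \<Rightarrow> 'w \<Rightarrow> state) \<Rightarrow> bool" where
  "ergodic_chain E M X \<longleftrightarrow>
     (\<forall>x\<in>E. \<forall>y\<in>E. \<exists>t\<ge>0. trans_prob M X t x y > 0)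
     \<and> (\<forall>x\<in>E. (\<integral>\<^sup>+w. return_time X x w \<partial>M x) < \<infinity>)"

section \<open>Communication and stationarity in terms of a q-matrix\<close>

definition leads_to :: "state set \<Rightarrow> (state \<Rightarrow> state \<Rightarrow> real) \<Rightarrow> state \<Rightarrow> state \<Rightarrow> bool" where
  "leads_to E Q x y \<longleftrightarrow> (x, y) \<in> {(u, w). u \<in> E \<and> w \<in> E \<and> u \<noteq> w \<and> Q u w > 0}\<^sup>*"

definition communicating_classes :: "state set \<Rightarrow> (state \<Rightarrow> state \<Rightarrow> real) \<Rightarrow> state set set" where
  "communicating_classes E Q =
     E // {(x, y). x \<in> E \<and> y \<in> E \<and> leads_to E Q x y \<and> leads_to E Q y x}"

definition irreducible_qmatrix :: "state set \<Rightarrow> (state \<Rightarrow> state \<Rightarrow> real) \<Rightarrow> bool" where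
  "irreducible_qmatrix E Q \<longleftrightarrow> (\<forall>x\<in>E. \<forall>y\<in>E. leads_to E Q x y)"

definition stationary_distribution ::
  "state set \<Rightarrow> (state \<Rightarrow> state \<Rightarrow> real) \<Rightarrow> (state \<Rightarrow> real) \<Rightarrow> bool" where
  "stationary_distribution E Q p \<longleftrightarrow>
     (\<forall>x\<in>E. p x \<ge> 0) \<and> (p has_sum 1) E \<and> (\<forall>y\<in>E. ((\<lambda>x. p x * Q x y) has_sum 0) E)"

section \<open>Level-dependent QBDs and the LC-block-augmented truncation\<close>

definition ld_qbd ::
  "(nat \<Rightarrow> nat) \<Rightarrow> (state \<Rightarrow> state \<Rightarrow> real) \<Rightarrow> (nat \<Rightarrow> int \<Rightarrow> nat \<Rightarrow> nat \<Rightarrow> real) \<Rightarrow> bool" where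
  "ld_qbd S Q A \<longleftrightarrow>
     (\<forall>k. \<forall>i\<le>S k. \<forall>j\<le>S (k + 1). Q (k, i) (k + 1, j) = A k 1 i j)
     \<and> (\<forall>k. \<forall>i\<le>S k. \<forall>j\<le>S k. Q (k, i) (k, j) = A k 0 i j)
     \<and> (\<forall>k\<ge>1. \<forall>i\<le>S k. \<forall>j\<le>S (k - 1). Q (k, i) (k - 1, j) = A k (- 1) i j)
     \<and> (\<forall>k l. k + 2 \<le> l \<or> l + 2 \<le> k \<longrightarrow> (\<forall>i\<le>S k. \<forall>j\<le>S l. Q (k, i) (l, j) = 0))"

text \<open>
  Adding the blocks \<open>Q(k;m)\<close> with \<open>m > n\<close> to column block \<open>n\<close> presupposes \<open>n \<ge> 1\<close>, where all
  column blocks have the same width.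
\<close>

fun lc_trunc :: "nat \<Rightarrow> (state \<Rightarrow> state \<Rightarrow> real) \<Rightarrow> state \<Rightarrow> state \<Rightarrow> real" where
  "lc_trunc n Q (k, i) (l, j) =
     (if l < n then Q (k, i) (l, j)
      else if l = n then Q (k, i) (n, j) + (\<Sum>\<^sub>\<infinity>m\<in>{m. m > n \<and> m \<noteq> k}. Q (k, i) (m, j))
      else if k = l then Q (k, i) (l, j)
      else 0)"

section \<open>Resolvent kernels\<close>

definition resolvent_kernel :: "real \<Rightarrow> (real \<Rightarrow> state \<Rightarrow> state \<Rightarrow> real) \<Rightarrow> state \<Rightarrow> state \<Rightarrow> real" where
  "resolvent_kernel \<beta> P x y = (LINT t:{0..}|lborel. \<beta> * exp (- \<beta> * t) * P t x y)"

text \<open>Powers and exponential of a matrix indexed by a finite set \<open>B\<close>.\<close>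

primrec mat_power :: "state set \<Rightarrow> (state \<Rightarrow> state \<Rightarrow> real) \<Rightarrow> nat \<Rightarrow> state \<Rightarrow> state \<Rightarrow> real" where
  "mat_power B G 0 x y = of_bool (x = y)"
| "mat_power B G (Suc m) x y = (\<Sum>z\<in>B. G x z * mat_power B G m z y)"

definition mat_exp :: "state set \<Rightarrow> (state \<Rightarrow> state \<Rightarrow> real) \<Rightarrow> state \<Rightarrow> state \<Rightarrow> real" where
  "mat_exp B G x y = (\<Sum>m. mat_power B G m x y / fact m)"

definition trunc_resolvent ::
  "(nat \<Rightarrow> nat) \<Rightarrow> (state \<Rightarrow> state \<Rightarrow> real) \<Rightarrow> real \<Rightarrow> nat \<Rightarrow> state \<Rightarrow> state \<Rightarrow> real" where
  "trunc_resolvent S Q \<beta> N =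
     resolvent_kernel \<beta> (\<lambda>t. mat_exp (levels_upto S N) (\<lambda>x y. Q x y * t))"

definition phi_bar ::
  "(nat \<Rightarrow> nat) \<Rightarrow> (state \<Rightarrow> state \<Rightarrow> real) \<Rightarrow> real \<Rightarrow> nat \<Rightarrow> nat \<Rightarrow> real" where
  "phi_bar S Q \<beta> K N =
     (SUP y\<in>levels_upto S N. MIN x\<in>levels_upto S K. trunc_resolvent S Q \<beta> N x y)"

section \<open>Weighted sums\<close>

text \<open>
  The product of a nonnegative row vector and a nonnegative column vector, taken in
  \<open>[0,\<infinity>]\<close> so that a divergent series has value \<open>\<infinity>\<close>.
\<close>

definition weighted :: "state set \<Rightarrow> (state \<Rightarrow> real) \<Rightarrow> (state \<Rightarrow> real) \<Rightarrow> ennreal" where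
  "weighted E p g = (\<Sum>\<^sub>\<infinity>x\<in>E. ennreal (p x * g x))"

end

theory Submission
  imports Defs
begin

text \<open>
  Fix \<open>n \<ge> 1\<close>, write \<open>\<mu>\<close> for the stationary distribution of the truncation and \<open>Q_m\<close> for the
  northwest corner of \<open>Q\<close> on the levels up to \<open>m\<close>. For \<open>1 \<le> g \<le> c v\<close> the error \<open>\<bar>p - \<mu>\<bar> g\<close> equals
  \<open>- 2 (p g) (\<mu> h)\<close>, where \<open>h\<close> is \<open>sgn (p - \<mu>) g\<close> minus its \<open>p\<close>-mean, divided by \<open>2 (p g)\<close>. Both
  \<open>g\<close> and \<open>p g\<close> are at most \<open>(p g) c v\<close>, so \<open>\<bar>h\<bar> \<le> c v\<close>, and \<open>p h = 0\<close>. What has to be bounded is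
  \<open>\<bar>\<mu> h\<bar>\<close>, uniformly in such \<open>h\<close>.

  Let \<open>f\<close> be the Dirichlet solution \<open>(\<alpha> - Q_m)\<^sup>-\<^sup>1 h\<close>, with \<open>m > n\<close>. The truncation differs from \<open>Q\<close>
  on its support only by redirecting jumps from level \<open>n\<close> to level \<open>n + 1\<close> back into level \<open>n\<close>.
  Testing the stationarity of \<open>\<mu>\<close> against \<open>f\<close> therefore gives (\<open>lc_trunc_flux\<close>)
  \<open>\<mu> h = \<alpha> (\<mu> f) - \<mu>(n) A_n(1) (f(n+1) - f(n))\<close>. It remains to bound the differences of \<open>f\<close> and to
  remove the first term, by letting first \<open>m \<longlongrightarrow> \<infinity>\<close> and then \<open>\<alpha> \<longlongrightarrow> 0\<close> (\<open>flux_bound\<close>).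

  For the differences, let \<open>y0\<close> attain the supremum in \<open>\<epsilon> = phi_bar\<close> and let \<open>\<psi>\<close> be the column \<open>y0\<close>
  of the resolvent on the levels up to \<open>N\<close>, extended by zero. Then \<open>Q \<psi> = \<beta> \<psi> \<ge> \<beta> \<epsilon>\<close> on the levels up
  to \<open>K\<close> and \<open>Q \<psi> \<ge> 0\<close> elsewhere, always away from \<open>y0\<close>. Hence \<open>W = v + b/(\<beta> \<epsilon>) (1 - \<psi>)\<close> satisfies
  \<open>Q W \<le> - c v\<close> away from \<open>y0\<close> (\<open>hitting_comparison_exists\<close>). Probabilistically, \<open>W\<close> dominates the
  expected integral of \<open>c v\<close> up to the time at which \<open>y0\<close> is hit. The minimum principle for finite
  sub-generators then compares \<open>f\<close> with \<open>W\<close> (\<open>pot_comparison\<close>): up to a multiple of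
  \<open>\<alpha> (\<alpha> - Q_m)\<^sup>-\<^sup>1 1\<close>, which is asymptotically constant, \<open>\<bar>f\<bar>\<close> is at most \<open>(1 + o(1)) W\<close>. Since
  \<open>W(x) + W(y) \<le> v(x) + v(y) + 2 b/(\<beta> \<epsilon>)\<close>, the differences of \<open>f\<close> are within the stated bound.

  The multiple just mentioned stays bounded as \<open>\<alpha> \<longlongrightarrow> 0\<close> because \<open>p h = 0\<close>: the measures
  \<open>\<alpha> p (\<alpha> - Q_m)\<^sup>-\<^sup>1\<close> lie below \<open>p\<close>, and they converge to \<open>p\<close> because no mass is lost
  (\<open>occ_tendsto\<close>). This is where non-explosion enters, in the form
  \<open>\<alpha> (\<alpha> - Q_m)\<^sup>-\<^sup>1 1 \<longlongrightarrow> 1\<close> (\<open>honest_resolvent\<close>). It is derived from the paths: up to a fixed time a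
  regular-jump path visits finitely many levels, so for large \<open>m\<close> the chain is unlikely to leave the
  levels up to \<open>m\<close>, and the chain observed on a fine time grid and killed on leaving these levels has
  a resolvent close to that of \<open>Q_m\<close>.
\<close>

section \<open>Exponentials of finite matrices\<close>

lemma mat_power_scale:
  "mat_power B (\<lambda>x y. G x y * t) m x y = mat_power B G m x y * t ^ m"
  by (induction m arbitrary: x) (simp_all add: sum_distrib_left mult_ac)

lemma mat_power_Suc_fact:
  "real (Suc m) * (mat_power B G (Suc m) x y / fact (Suc m))
   = (\<Sum>z\<in>B. G x z * (mat_power B G m z y / fact m))"
proof -
  have "real (Suc m) * (u / fact (Suc m)) = u / fact m" for u :: real
    unfolding fact_Suc by (simp del: of_nat_Suc)
  then have "real (Suc m) * (mat_power B G (Suc m) x y / fact (Suc m)) = mat_power B G (Suc m) x y / fact m" .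
  then show ?thesis
    by (simp add: sum_divide_distrib)
qed

lemma mat_power_bound:
  assumes "finite B" "x \<in> B"
  shows "\<bar>mat_power B G m x y\<bar> \<le> (\<Sum>u\<in>B. \<Sum>w\<in>B. \<bar>G u w\<bar>) ^ m"
  using assms(2)
proof (induction m arbitrary: x)
  case (Suc m)
  let ?C = "\<Sum>u\<in>B. \<Sum>w\<in>B. \<bar>G u w\<bar>"
  have C0: "?C \<ge> 0" by (intro sum_nonneg) auto
  have "\<bar>mat_power B G (Suc m) x y\<bar> \<le> (\<Sum>z\<in>B. \<bar>G x z\<bar> * \<bar>mat_power B G m z y\<bar>)"
    by (simp add: abs_mult[symmetric] sum_abs)
  also have "\<dots> \<le> (\<Sum>z\<in>B. \<bar>G x z\<bar> * ?C ^ m)"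
    by (intro sum_mono mult_left_mono Suc.IH) auto
  also have "\<dots> = (\<Sum>z\<in>B. \<bar>G x z\<bar>) * ?C ^ m"
    by (simp add: sum_distrib_right)
  also have "\<dots> \<le> ?C * ?C ^ m"
    using Suc.prems assms(1) C0
    by (intro mult_right_mono member_le_sum[where f = "\<lambda>u. \<Sum>w\<in>B. \<bar>G u w\<bar>"])
      (auto intro: sum_nonneg)
  finally show ?case by simp
qed simp

lemma summable_mat_exp_series:
  fixes t :: real
  assumes "finite B" "x \<in> B"
  shows "summable (\<lambda>m. \<bar>mat_power B G m x y / fact m * t ^ m\<bar>)"
proof (rule summable_comparison_test')
  let ?C = "\<Sum>u\<in>B. \<Sum>w\<in>B. \<bar>G u w\<bar>"
  show "summable (\<lambda>m. (?C * \<bar>t\<bar>) ^ m /\<^sub>R fact m)"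
    by (rule summable_exp_generic)
  show "norm \<bar>mat_power B G m x y / fact m * t ^ m\<bar> \<le> (?C * \<bar>t\<bar>) ^ m /\<^sub>R fact m" for m
    using mat_power_bound[OF assms, of G m y]
    by (simp add: abs_mult power_mult_distrib power_abs divide_simps mult_right_mono)
qed

lemma mat_exp_scale:
  "mat_exp B (\<lambda>x y. G x y * t) x y = (\<Sum>m. mat_power B G m x y / fact m * t ^ m)"
  by (simp add: mat_exp_def mat_power_scale)

lemma mat_exp_zero: "mat_exp B (\<lambda>x y. G x y * 0) x y = of_bool (x = y)"
proof -
  have "(\<Sum>m. mat_power B G m x y / fact m * 0 ^ m) = (\<Sum>m\<in>{0}. mat_power B G m x y / fact m * 0 ^ m)"
    by (rule suminf_finite) auto
  then show ?thesis unfolding mat_exp_scale by simp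
qed

lemma mat_exp_has_derivative:
  assumes "finite B" "x \<in> B"
  shows "((\<lambda>t. mat_exp B (\<lambda>x y. G x y * t) x y) has_real_derivative
            (\<Sum>z\<in>B. G x z * mat_exp B (\<lambda>x y. G x y * t) z y)) (at t)"
proof -
  let ?a = "\<lambda>x m. mat_power B G m x y / fact m"
  have sm: "summable (\<lambda>m. ?a z m * u ^ m)" if "z \<in> B" for z and u :: real
    by (rule summable_rabs_cancel[OF summable_mat_exp_series[OF assms(1) that]])
  have "((\<lambda>t. \<Sum>m. ?a x m * t ^ m) has_real_derivative (\<Sum>m. diffs (?a x) m * t ^ m)) (at t)"
    by (rule termdiffs_strong_converges_everywhere) (rule sm[OF assms(2)])
  also have "(\<Sum>m. diffs (?a x) m * t ^ m) = (\<Sum>m. \<Sum>z\<in>B. G x z * (?a z m * t ^ m))"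
  proof (rule arg_cong[where f = suminf], rule ext)
    fix m
    have "diffs (?a x) m = (\<Sum>z\<in>B. G x z * ?a z m)"
      unfolding diffs_def by (rule mat_power_Suc_fact)
    then show "diffs (?a x) m * t ^ m = (\<Sum>z\<in>B. G x z * (?a z m * t ^ m))"
      by (simp only: sum_distrib_right mult.assoc)
  qed
  also have "\<dots> = (\<Sum>z\<in>B. \<Sum>m. G x z * (?a z m * t ^ m))"
    by (rule suminf_sum) (intro summable_mult sm)
  also have "\<dots> = (\<Sum>z\<in>B. G x z * (\<Sum>m. ?a z m * t ^ m))"
    by (intro sum.cong suminf_mult sm refl)
  finally show ?thesis unfolding mat_exp_scale .
qed

text \<open>
  The divided powers of \<open>G + a I\<close> form the Cauchy product of those of \<open>a\<close> and of \<open>G\<close>. Both sides obey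
  the recursion \<open>(n + 1) u (n + 1) = (G + a I) u n\<close>; on the right the factor \<open>n + 1\<close> is split as
  \<open>i + (n + 1 - i)\<close>.
\<close>
lemma mat_power_shift:
  fixes a :: real
  assumes "finite B" "x \<in> B"
  shows "mat_power B (\<lambda>x y. G x y + of_bool (x = y) * a) n x y / fact n
         = (\<Sum>i\<le>n. a ^ i / fact i * (mat_power B G (n - i) x y / fact (n - i)))"
  using assms(2)
proof (induction n arbitrary: x)
  case (Suc n)
  let ?G = "\<lambda>x y. G x y + of_bool (x = y) * a"
  let ?e = "\<lambda>i. a ^ i / fact i"
  let ?b = "\<lambda>x m. mat_power B G m x y / fact m"
  let ?s = "\<lambda>x n. \<Sum>i\<le>n. ?e i * ?b x (n - i)"
  have e: "real (Suc i) * ?e (Suc i) = a * ?e i" for i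
    by (simp add: field_simps del: of_nat_Suc)
  have b: "real (Suc m) * ?b x (Suc m) = (\<Sum>z\<in>B. G x z * ?b z m)" for m
    by (rule mat_power_Suc_fact)
  have "real (Suc n) * (mat_power B ?G (Suc n) x y / fact (Suc n))
        = (\<Sum>z\<in>B. ?G x z * (mat_power B ?G n z y / fact n))"
    by (rule mat_power_Suc_fact)
  also have "\<dots> = (\<Sum>z\<in>B. ?G x z * ?s z n)"
    by (intro sum.cong refl) (simp add: Suc.IH)
  also have "\<dots> = (\<Sum>z\<in>B. G x z * ?s z n) + (\<Sum>z\<in>B. if x = z then a * ?s z n else 0)"
    unfolding sum.distrib[symmetric] by (intro sum.cong refl) (simp add: algebra_simps)
  also have "\<dots> = (\<Sum>z\<in>B. G x z * ?s z n) + a * ?s x n"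
    using Suc.prems assms(1) by (simp add: sum.delta')
  also have "(\<Sum>z\<in>B. G x z * ?s z n) = (\<Sum>i\<le>n. ?e i * (\<Sum>z\<in>B. G x z * ?b z (n - i)))"
    unfolding sum_distrib_left by (subst sum.swap) (simp only: mult.left_commute)
  also have "\<dots> = (\<Sum>i\<le>n. ?e i * (real (Suc n - i) * ?b x (Suc n - i)))"
    by (intro sum.cong refl) (simp only: b[symmetric] Suc_diff_le atMost_iff)
  also have "\<dots> = (\<Sum>i\<le>Suc n. real (Suc n - i) * (?e i * ?b x (Suc n - i)))"
    by (simp add: mult_ac)
  also have "a * ?s x n = (\<Sum>i\<le>n. (a * ?e i) * ?b x (n - i))"
    by (simp only: sum_distrib_left mult.assoc)
  also have "\<dots> = (\<Sum>i\<le>n. real (Suc i) * ?e (Suc i) * ?b x (Suc n - Suc i))"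
    by (simp only: e diff_Suc_Suc)
  also have "\<dots> = (\<Sum>i\<le>Suc n. real i * (?e i * ?b x (Suc n - i)))"
    by (subst sum.atMost_Suc_shift) (simp add: mult_ac)
  also have "(\<Sum>i\<le>Suc n. real (Suc n - i) * (?e i * ?b x (Suc n - i)))
             + (\<Sum>i\<le>Suc n. real i * (?e i * ?b x (Suc n - i))) = real (Suc n) * ?s x (Suc n)"
    unfolding sum.distrib[symmetric] sum_distrib_left
    by (intro sum.cong refl) (subst distrib_right[symmetric], simp add: of_nat_diff)
  finally show ?case by (simp only: mult_cancel_left) simp
qed simp

text \<open>
  This permits uniformization: a sub-generator becomes a nonnegative matrix after adding a large
  multiple of the identity.
\<close>
lemma mat_exp_shift:
  fixes a t :: real
  assumes "finite B" "x \<in> B"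
  shows "mat_exp B (\<lambda>x y. (G x y + of_bool (x = y) * a) * t) x y
         = exp (a * t) * mat_exp B (\<lambda>x y. G x y * t) x y"
proof -
  let ?b = "\<lambda>m. mat_power B G m x y / fact m * t ^ m"
  let ?e = "\<lambda>i. (a * t) ^ i /\<^sub>R fact i"
  have "(\<lambda>k. \<Sum>i\<le>k. ?e i * ?b (k - i)) sums (suminf ?e * suminf ?b)"
    using summable_mat_exp_series[OF assms] summable_norm_exp[of "a * t"]
    by (intro Cauchy_product_sums) auto
  moreover have "(\<Sum>i\<le>k. ?e i * ?b (k - i))
      = mat_power B (\<lambda>x y. G x y + of_bool (x = y) * a) k x y / fact k * t ^ k" for k
    unfolding mat_power_shift[OF assms] sum_distrib_right
    by (intro sum.cong refl)
      (simp add: power_mult_distrib divide_simps power_add[symmetric] mult_ac)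
  ultimately show ?thesis
    unfolding mat_exp_scale by (simp add: sums_iff exp_def)
qed

section \<open>Resolvents of finite sub-generators\<close>

locale sub_generator =
  fixes B :: "state set" and Q :: "state \<Rightarrow> state \<Rightarrow> real"
  assumes finite_B: "finite B"
    and off_diagonal_nonneg: "\<And>x y. x \<in> B \<Longrightarrow> y \<in> B \<Longrightarrow> x \<noteq> y \<Longrightarrow> 0 \<le> Q x y"
    and row_sum_nonpos: "\<And>x. x \<in> B \<Longrightarrow> (\<Sum>y\<in>B. Q x y) \<le> 0"
begin

text \<open>
  At a negative minimum inside \<open>D\<close> the generator term is nonnegative, because the row sums are
  nonpositive and all other values are at least the minimum; this contradicts the inequality there.
  With \<open>D = B\<close> it says that \<open>\<alpha> - Q\<close> has a nonnegative inverse on \<open>B\<close>.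
\<close>
lemma min_principle:
  assumes "\<alpha> > 0"
    and super: "\<And>x. x \<in> D \<Longrightarrow> x \<in> B \<Longrightarrow> 0 \<le> \<alpha> * u x - (\<Sum>y\<in>B. Q x y * u y)"
    and bdry: "\<And>x. x \<in> B \<Longrightarrow> x \<notin> D \<Longrightarrow> 0 \<le> u x"
    and "x \<in> B"
  shows "0 \<le> (u x :: real)"
proof -
  obtain m where m: "m \<in> B" "\<And>y. y \<in> B \<Longrightarrow> u m \<le> u y"
    using finite_B \<open>x \<in> B\<close> ex_min_if_finite[of "u ` B"]
    by (metis (no_types, lifting) arg_min_if_finite(1) arg_min_least empty_iff)
  have "0 \<le> u m"
  proof (rule ccontr)
    assume neg: "\<not> 0 \<le> u m"
    then have "m \<in> D" using bdry[OF m(1)] by blast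
    have "0 \<le> (\<Sum>y\<in>B. Q m y) * u m"
      using neg row_sum_nonpos[OF m(1)] by (simp add: mult_nonpos_nonpos)
    also have "\<dots> \<le> (\<Sum>y\<in>B. Q m y * u y)"
      unfolding sum_distrib_right
    proof (rule sum_mono)
      fix y assume "y \<in> B"
      show "Q m y * u m \<le> Q m y * u y"
        using off_diagonal_nonneg[OF m(1) \<open>y \<in> B\<close>] m(2)[OF \<open>y \<in> B\<close>]
        by (cases "y = m") (simp_all add: mult_left_mono)
    qed
    finally show False
      using super[OF \<open>m \<in> D\<close> m(1)] neg \<open>\<alpha> > 0\<close> mult_pos_neg[of \<alpha> "u m"] by linarith
  qed
  then show ?thesis using m(2)[OF \<open>x \<in> B\<close>] by linarith
qed

text \<open>
  Uniformization: \<open>Q + \<theta> I\<close> is nonnegative with row sums at most \<open>\<theta>\<close>, so its exponential lies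
  between \<open>0\<close> and \<open>exp (\<theta> t)\<close>.
\<close>
lemma mat_exp_bounds:
  assumes "t \<ge> 0" "x \<in> B" "y \<in> B"
  shows "0 \<le> mat_exp B (\<lambda>x y. Q x y * t) x y" "mat_exp B (\<lambda>x y. Q x y * t) x y \<le> 1"
proof -
  define \<theta> where "\<theta> = (\<Sum>x\<in>B. \<bar>Q x x\<bar>)"
  define G where "G = (\<lambda>x y. Q x y + of_bool (x = y) * \<theta>)"
  have "\<theta> \<ge> 0" unfolding \<theta>_def by (intro sum_nonneg) auto
  have G_nonneg: "0 \<le> G x y" if "x \<in> B" "y \<in> B" for x y
  proof (cases "x = y")
    case True
    have "\<bar>Q x x\<bar> \<le> \<theta>"
      unfolding \<theta>_def using finite_B that by (intro member_le_sum[where f = "\<lambda>x. \<bar>Q x x\<bar>"]) auto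
    then show ?thesis using True by (simp add: G_def)
  qed (use off_diagonal_nonneg that in \<open>simp add: G_def\<close>)
  have G_row: "(\<Sum>y\<in>B. G x y) \<le> \<theta>" if "x \<in> B" for x
  proof -
    have "(\<Sum>y\<in>B. of_bool (x = y) * \<theta>) = (\<Sum>y\<in>B. if x = y then \<theta> else 0)"
      by (intro sum.cong) auto
    then show ?thesis
      using row_sum_nonpos[OF that] that finite_B by (simp add: G_def sum.distrib)
  qed
  have pow: "0 \<le> mat_power B G m x y \<and> mat_power B G m x y \<le> \<theta> ^ m" if "x \<in> B" for m x
    using that
  proof (induction m arbitrary: x)
    case (Suc m)
    have "(\<Sum>z\<in>B. G x z * mat_power B G m z y) \<le> (\<Sum>z\<in>B. G x z) * \<theta> ^ m"
      unfolding sum_distrib_right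
      by (intro sum_mono mult_left_mono) (use Suc G_nonneg in auto)
    also have "\<dots> \<le> \<theta> * \<theta> ^ m"
      using G_row[OF Suc.prems] \<open>\<theta> \<ge> 0\<close> by (intro mult_right_mono) auto
    finally show ?case
      using Suc.IH Suc.prems G_nonneg by (simp add: sum_nonneg)
  qed auto
  let ?E = "mat_exp B (\<lambda>x y. G x y * t) x y"
  have sm: "summable (\<lambda>m. mat_power B G m x y / fact m * t ^ m)"
    by (rule summable_rabs_cancel[OF summable_mat_exp_series[OF finite_B \<open>x \<in> B\<close>]])
  have "0 \<le> ?E"
    unfolding mat_exp_scale using pow[OF \<open>x \<in> B\<close>] \<open>t \<ge> 0\<close> by (intro suminf_nonneg sm) auto
  have "?E \<le> (\<Sum>m. (\<theta> * t) ^ m /\<^sub>R fact m)"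
    unfolding mat_exp_scale
  proof (intro suminf_le sm summable_exp_generic)
    show "mat_power B G m x y / fact m * t ^ m \<le> (\<theta> * t) ^ m /\<^sub>R fact m" for m
      using mult_right_mono[OF conjunct2[OF pow[OF \<open>x \<in> B\<close>, of m]], of "t ^ m"] \<open>t \<ge> 0\<close>
      by (simp add: power_mult_distrib divide_simps)
  qed
  then have "?E \<le> exp (\<theta> * t)" by (simp add: exp_def)
  moreover have "?E = exp (\<theta> * t) * mat_exp B (\<lambda>x y. Q x y * t) x y"
    unfolding G_def by (rule mat_exp_shift[OF finite_B \<open>x \<in> B\<close>])
  ultimately show "0 \<le> mat_exp B (\<lambda>x y. Q x y * t) x y" "mat_exp B (\<lambda>x y. Q x y * t) x y \<le> 1"
    using \<open>0 \<le> ?E\<close> by (simp_all add: zero_le_mult_iff)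
qed

definition res :: "real \<Rightarrow> state \<Rightarrow> state \<Rightarrow> real" where
  "res \<alpha> = resolvent_kernel \<alpha> (\<lambda>t. mat_exp B (\<lambda>x y. Q x y * t))"

lemma res_nonneg:
  assumes "\<alpha> > 0" "x \<in> B" "y \<in> B"
  shows "0 \<le> res \<alpha> x y"
  unfolding res_def resolvent_kernel_def set_lebesgue_integral_def
  using assms by (intro Bochner_Integration.integral_nonneg)
    (auto simp: indicator_def intro!: mat_exp_bounds mult_nonneg_nonneg)

text \<open>
  The matrix identity \<open>(\<alpha> - Q) \<integral> exp (- \<alpha> t) exp (Q t) dt = I\<close>, obtained by integrating the derivative
  of \<open>exp (- \<alpha> t) exp (Q t)\<close> over the half line.
\<close>
lemma res_equation:
  assumes "\<alpha> > 0" "x \<in> B" "y \<in> B"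
  shows "\<alpha> * res \<alpha> x y - (\<Sum>z\<in>B. Q x z * res \<alpha> z y) = \<alpha> * of_bool (x = y)"
proof -
  let ?E = "\<lambda>z t. mat_exp B (\<lambda>x y. Q x y * t) z y"
  let ?g = "\<lambda>z t. exp (- \<alpha> * t) * ?E z t"
  let ?I = "\<lambda>z. LINT t:{0<..}|lborel. ?g z t"
  let ?f = "\<lambda>t. (\<Sum>z\<in>B. Q x z * ?g z t) - \<alpha> * ?g x t"
  have cont: "continuous_on UNIV (?E z)" if "z \<in> B" for z
    using mat_exp_has_derivative[OF finite_B that]
    by (meson DERIV_isCont continuous_at_imp_continuous_on)
  have cont_g: "continuous_on UNIV (?g z)" if "z \<in> B" for z
    by (intro continuous_intros cont[OF that])
  have res: "res \<alpha> z y = \<alpha> * ?I z" for z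
  proof -
    have "res \<alpha> z y = (LINT t:{0..}|lborel. \<alpha> * ?g z t)"
      unfolding res_def resolvent_kernel_def by (simp add: mult.assoc)
    also have "\<dots> = (LINT t:{0<..}|lborel. \<alpha> * ?g z t)"
      by (rule set_integral_discrete_difference[where X = "{0}"]) auto
    finally show ?thesis by simp
  qed
  have int: "set_integrable lborel {0<..} (?g z)" if "z \<in> B" for z
  proof (rule set_integrable_bound[OF integrable_I0i_exp_mscale[OF \<open>\<alpha> > 0\<close>]])
    show "set_borel_measurable lborel {0<..} (?g z)"
      unfolding set_borel_measurable_def
      using borel_measurable_continuous_onI[OF cont_g[OF that]] by measurable
    show "AE t in lborel. t \<in> {0<..} \<longrightarrow> norm (?g z t) \<le> norm (exp (- (t * \<alpha>)))"
      using mat_exp_bounds[OF _ that \<open>y \<in> B\<close>]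
      by (intro AE_I2) (auto simp: abs_mult mult.commute[of \<alpha>] intro!: mult_left_le)
  qed
  have int_sum: "set_integrable lborel {0<..} (\<lambda>t. \<Sum>z\<in>B. Q x z * ?g z t)"
    using int unfolding set_integrable_def scaleR_sum_right
    by (intro Bochner_Integration.integrable_sum) (simp add: mult.left_commute[of "indicator _ _"])
  have int_f: "set_integrable lborel {0<..} ?f"
    by (intro set_integral_diff set_integrable_mult_right int int_sum assms)
  have deriv: "(?g x has_real_derivative ?f t) (at t)" for t
    by (rule derivative_eq_intros mat_exp_has_derivative[OF finite_B \<open>x \<in> B\<close>] refl)+
      (simp add: sum_distrib_left algebra_simps)
  have cont_f: "isCont ?f t" for t
    by (intro continuous_diff continuous_sum continuous_mult continuous_const
        continuous_on_interior[OF cont_g] assms) auto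
  have "(LBINT t=0..\<infinity>. ?f t) = 0 - of_bool (x = y)"
  proof (rule interval_integral_FTC_integrable[where F = "?g x"])
    show "(?g x has_vector_derivative ?f t) (at t)" for t
      using deriv by (simp add: has_real_derivative_iff_has_vector_derivative)
    show "set_integrable lborel (einterval 0 \<infinity>) ?f"
      using int_f by (simp add: zero_ereal_def)
    have "(?g x \<longlongrightarrow> ?g x 0) (at_right 0)"
      using DERIV_isCont[OF deriv, of 0] by (simp add: isCont_def filterlim_at_split)
    moreover have "?g x 0 = of_bool (x = y)"
      using mat_exp_zero[of B Q x y] by simp
    ultimately have "(?g x \<longlongrightarrow> of_bool (x = y)) (at_right 0)"
      by (simp only:)
    then show "((?g x \<circ> real_of_ereal) \<longlongrightarrow> of_bool (x = y)) (at_right 0)"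
      unfolding zero_ereal_def by (simp only: ereal_tendsto_simps)
    have "((\<lambda>t. exp (- \<alpha> * t)) \<longlongrightarrow> 0) at_top"
      using \<open>\<alpha> > 0\<close> by real_asymp
    then have "(?g x \<longlongrightarrow> 0) at_top"
    proof (rule Lim_null_comparison[rotated])
      show "\<forall>\<^sub>F t in at_top. norm (?g x t) \<le> exp (- \<alpha> * t)"
        using mat_exp_bounds[OF _ \<open>x \<in> B\<close> \<open>y \<in> B\<close>]
        by (intro eventually_mono[OF eventually_ge_at_top[of 0]])
          (auto simp: abs_mult intro!: mult_left_le)
    qed
    then show "((?g x \<circ> real_of_ereal) \<longlongrightarrow> 0) (at_left \<infinity>)"
      by (simp add: ereal_tendsto_simps)
  qed (use cont_f in auto)
  moreover have "(LBINT t=0..\<infinity>. ?f t) = (\<Sum>z\<in>B. Q x z * ?I z) - \<alpha> * ?I x"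
  proof -
    have "(LINT t:{0<..}|lborel. \<Sum>z\<in>B. Q x z * ?g z t) = (\<Sum>z\<in>B. LINT t:{0<..}|lborel. Q x z * ?g z t)"
      unfolding set_lebesgue_integral_def scaleR_sum_right
      by (rule Bochner_Integration.integral_sum)
        (use int in \<open>auto simp: set_integrable_def mult.left_commute[of "indicator _ _"]\<close>)
    then show ?thesis
      unfolding interval_lebesgue_integral_0_infty
      using int[OF \<open>x \<in> B\<close>] int_sum by (subst set_integral_diff(2)) auto
  qed
  ultimately have "\<alpha> * ((\<Sum>z\<in>B. Q x z * ?I z) - \<alpha> * ?I x) = \<alpha> * (- of_bool (x = y))"
    by simp
  then show ?thesis
    unfolding res by (simp add: algebra_simps sum_distrib_left)
qed

lemma potential_equation:
  assumes "\<alpha> > 0" "x \<in> B"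
  shows "\<alpha> * (\<Sum>y\<in>B. res \<alpha> x y * h y) - (\<Sum>z\<in>B. Q x z * (\<Sum>y\<in>B. res \<alpha> z y * h y)) = \<alpha> * h x"
proof -
  have "\<alpha> * (\<Sum>y\<in>B. res \<alpha> x y * h y) - (\<Sum>z\<in>B. Q x z * (\<Sum>y\<in>B. res \<alpha> z y * h y))
        = (\<Sum>y\<in>B. \<alpha> * res \<alpha> x y * h y) - (\<Sum>y\<in>B. \<Sum>z\<in>B. Q x z * res \<alpha> z y * h y)"
    by (subst sum.swap) (simp add: sum_distrib_left mult.assoc)
  also have "\<dots> = (\<Sum>y\<in>B. (\<alpha> * res \<alpha> x y - (\<Sum>z\<in>B. Q x z * res \<alpha> z y)) * h y)"
    by (simp add: sum_subtractf left_diff_distrib sum_distrib_right)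
  also have "\<dots> = (\<Sum>y\<in>B. if x = y then \<alpha> * h y else 0)"
    using assms by (intro sum.cong refl) (simp add: res_equation)
  also have "\<dots> = \<alpha> * h x" using assms finite_B by simp
  finally show ?thesis .
qed

lemma res_row_sum_le_1:
  assumes "\<alpha> > 0" "x \<in> B"
  shows "(\<Sum>y\<in>B. res \<alpha> x y) \<le> 1"
proof -
  let ?r = "\<lambda>x. \<Sum>y\<in>B. res \<alpha> x y"
  have "0 \<le> \<alpha> * (1 - ?r x) - (\<Sum>y\<in>B. Q x y * (1 - ?r y))" if "x \<in> B" for x
    using potential_equation[OF \<open>\<alpha> > 0\<close> that, of "\<lambda>_. 1"] row_sum_nonpos[OF that]
    by (simp add: algebra_simps sum_subtractf)
  then show ?thesis
    using min_principle[OF \<open>\<alpha> > 0\<close>, of B "\<lambda>x. 1 - ?r x" x] assms by auto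
qed

lemma res_le_1:
  assumes "\<alpha> > 0" "x \<in> B" "y \<in> B"
  shows "res \<alpha> x y \<le> 1"
proof -
  have "res \<alpha> x y \<le> (\<Sum>y\<in>B. res \<alpha> x y)"
    using assms finite_B by (intro member_le_sum res_nonneg) auto
  then show ?thesis using res_row_sum_le_1[OF assms(1,2)] by linarith
qed

end

section \<open>Non-explosion of regular-jump chains\<close>

text \<open>
  Around each time there is a punctured neighbourhood free of discontinuities, on whose two halves the
  discrete-valued path is constant. By compactness finitely many such neighbourhoods cover the
  interval.
\<close>
lemma regular_jump_path_bounded_level:
  assumes "regular_jump_path f" "u \<ge> 0"
  shows "\<exists>m. \<forall>t\<in>{0..u}. fst (f t) \<le> m"
proof -
  define D where "D = {t \<in> {0..u}. \<not> continuous (at t within {0..}) f}"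
  define g where "g = (\<lambda>t. real (fst (f t)))"
  have "finite D" using assms by (auto simp: regular_jump_path_def D_def)
  have const: "finite (g ` I)" if "connected I" "I \<subseteq> {0..u}" "I \<inter> D = {}" for I
  proof -
    have "continuous_on I f"
      unfolding continuous_on_eq_continuous_within
    proof
      fix s assume "s \<in> I"
      then have "continuous (at s within {0..}) f"
        using that(2,3) by (fastforce simp: D_def)
      then show "continuous (at s within I) f"
        by (rule continuous_within_subset) (use that(2) in auto)
    qed
    then have "continuous_on I g"
      unfolding g_def by (intro continuous_intros)
    moreover have "1 \<le> norm (g y - g x)" if "g y \<noteq> g x" for x y
      using that unfolding g_def by (cases "fst (f y) < fst (f x)") auto
    ultimately have "g constant_on I"
      by (intro continuous_discrete_range_constant[OF \<open>connected I\<close>]) (auto intro: exI[of _ 1])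
    then have "\<exists>c. g ` I \<subseteq> {c}" by (auto simp: constant_on_def)
    then show ?thesis using finite_subset by blast
  qed
  have "\<exists>e>0. finite (g ` (ball t e \<inter> {0..u}))" for t
  proof -
    obtain e where e: "e > 0" "\<And>s. s \<in> D \<Longrightarrow> s \<noteq> t \<Longrightarrow> e \<le> dist t s"
      using finite_set_avoid[OF \<open>finite D\<close>] by metis
    have "finite (g ` ({t - e<..<t} \<inter> {0..u}))" "finite (g ` ({t<..<t + e} \<inter> {0..u}))"
      using e by (intro const; force simp: dist_real_def intro: convex_connected convex_Int)+
    moreover have "g ` (ball t e \<inter> {0..u})
        \<subseteq> g ` ({t - e<..<t} \<inter> {0..u}) \<union> g ` ({t<..<t + e} \<inter> {0..u}) \<union> {g t}"
    proof
      fix y assume "y \<in> g ` (ball t e \<inter> {0..u})"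
      then obtain s where s: "s \<in> ball t e" "s \<in> {0..u}" "y = g s" by auto
      then have "s \<in> {t - e<..<t} \<or> s \<in> {t<..<t + e} \<or> s = t" by (auto simp: dist_real_def)
      then show "y \<in> g ` ({t - e<..<t} \<inter> {0..u}) \<union> g ` ({t<..<t + e} \<inter> {0..u}) \<union> {g t}"
        using s by auto
    qed
    ultimately show ?thesis
      using e(1) by (meson finite.emptyI finite.insertI finite_UnI finite_subset)
  qed
  then obtain e where e: "\<And>t. e t > 0" "\<And>t. finite (g ` (ball t (e t) \<inter> {0..u}))"
    by metis
  obtain C where C: "C \<subseteq> {0..u}" "finite C" "{0..u} \<subseteq> (\<Union>t\<in>C. ball t (e t))"
    by (rule compactE_image[OF compact_Icc, of "{0..u}" "\<lambda>t. ball t (e t)" 0 u]) (use e(1) in auto)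
  have "g ` {0..u} \<subseteq> (\<Union>t\<in>C. g ` (ball t (e t) \<inter> {0..u}))"
    using image_mono[of "{0..u}" "\<Union>t\<in>C. ball t (e t) \<inter> {0..u}" g] C(3) by (simp add: image_UN) blast
  then have "finite (g ` {0..u})"
    using C(2) e(2) by (meson finite_UN_I finite_subset)
  then have "bdd_above (g ` {0..u})" by (rule bdd_above_finite)
  then obtain c where c: "\<forall>t\<in>{0..u}. g t \<le> c" by (auto simp: bdd_above_def)
  have "\<forall>t\<in>{0..u}. fst (f t) \<le> nat \<lfloor>c\<rfloor>"
    using c unfolding g_def by (auto simp: le_nat_floor)
  then show ?thesis ..
qed

lemma mono_levels_upto: "m \<le> n \<Longrightarrow> levels_upto S m \<subseteq> levels_upto S n"
  by (auto simp: levels_upto_def)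

lemma levels_upto_subset: "levels_upto S m \<subseteq> state_space S"
  by (auto simp: levels_upto_def state_space_def)

lemma finite_levels_upto: "finite (levels_upto S m)"
proof (rule finite_subset)
  show "levels_upto S m \<subseteq> Sigma {..m} (\<lambda>k. {..S k})" by (auto simp: levels_upto_def)
qed auto

lemma state_in_levels_upto: "x \<in> state_space S \<Longrightarrow> x \<in> levels_upto S (fst x)"
  by (auto simp: levels_upto_def state_space_def)

lemma chain_event_sets:
  assumes "markov_chain E M X" "x \<in> E" "t \<ge> 0"
  shows "{w \<in> space (M x). X t w \<in> A} \<in> sets (M x)"
proof -
  have m: "X t \<in> measurable (M x) (count_space E)" using assms by (auto simp: markov_chain_def)
  have "X t -` (A \<inter> E) \<inter> space (M x) \<in> sets (M x)"
    by (rule measurable_sets[OF m]) auto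
  also have "X t -` (A \<inter> E) \<inter> space (M x) = {w \<in> space (M x). X t w \<in> A}"
    using measurable_space[OF m] by auto
  finally show ?thesis .
qed

lemma chain_event_sets_eq:
  assumes "markov_chain E M X" "x \<in> E" "t \<ge> 0"
  shows "{w \<in> space (M x). X t w = y} \<in> sets (M x)"
  using chain_event_sets[OF assms, of "{y}"] by simp

text \<open>
  The Markov property for the history event that all observations lie in \<open>B\<close>, summed over the finitely
  many histories in \<open>B\<close>.
\<close>
lemma markov_step_set:
  assumes mc: "markov_chain E M X" and "x \<in> E" and T: "finite T" "T \<subseteq> {0..s}"
    and "s \<ge> 0" "t \<ge> 0" and B: "finite B" "B \<subseteq> E" and "y \<in> E" "z \<in> E"
  shows "measure (M x) {w \<in> space (M x). (\<forall>r\<in>T. X r w \<in> B) \<and> X s w = y \<and> X (s + t) w = z}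
       = measure (M x) {w \<in> space (M x). (\<forall>r\<in>T. X r w \<in> B) \<and> X s w = y} * trans_prob M X t y z"
proof -
  interpret prob_space "M x" using mc \<open>x \<in> E\<close> by (auto simp: markov_chain_def)
  define P where "P = PiE T (\<lambda>_. B)"
  have "finite P" unfolding P_def using T B by (intro finite_PiE) auto
  have split: "measure (M x) {w \<in> space (M x). (\<forall>r\<in>T. X r w \<in> B) \<and> R w}
      = (\<Sum>h\<in>P. measure (M x) {w \<in> space (M x). (\<forall>r\<in>T. X r w = h r) \<and> R w})"
    if R: "{w \<in> space (M x). R w} \<in> sets (M x)" for R
  proof -
    let ?A = "\<lambda>h. {w \<in> space (M x). (\<forall>r\<in>T. X r w = h r) \<and> R w}"
    have "{w \<in> space (M x). (\<forall>r\<in>T. X r w \<in> B) \<and> R w} = (\<Union>h\<in>P. ?A h)"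
    proof (intro equalityI subsetI)
      fix w assume w: "w \<in> {w \<in> space (M x). (\<forall>r\<in>T. X r w \<in> B) \<and> R w}"
      then have "restrict (\<lambda>r. X r w) T \<in> P" by (auto simp: P_def)
      moreover have "w \<in> ?A (restrict (\<lambda>r. X r w) T)" using w by auto
      ultimately show "w \<in> (\<Union>h\<in>P. ?A h)" by blast
    qed (auto simp: P_def)
    moreover have "?A h \<in> sets (M x)" for h
    proof -
      have "{w \<in> space (M x). \<forall>r\<in>T. X r w = h r} \<in> sets (M x)"
        using T by (intro sets.sets_Collect_finite_All chain_event_sets_eq[OF mc \<open>x \<in> E\<close>]) auto
      then show ?thesis by (intro sets.sets_Collect_conj R)
    qed
    moreover have "disjoint_family_on ?A P"
      unfolding disjoint_family_on_def
    proof (intro ballI impI)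
      fix h h' assume "h \<in> P" "h' \<in> P" "h \<noteq> h'"
      then obtain r where "r \<in> T" "h r \<noteq> h' r"
        unfolding P_def by (meson PiE_ext)
      then show "?A h \<inter> ?A h' = {}" by auto
    qed
    ultimately show ?thesis
      using finite_measure_finite_Union[OF \<open>finite P\<close>, of ?A] by auto
  qed
  have ev: "{w \<in> space (M x). X s w = y} \<in> sets (M x)"
    "{w \<in> space (M x). X s w = y \<and> X (s + t) w = z} \<in> sets (M x)"
    using \<open>s \<ge> 0\<close> \<open>t \<ge> 0\<close> by (auto intro!: sets.sets_Collect_conj chain_event_sets_eq[OF mc \<open>x \<in> E\<close>])
  show ?thesis
    unfolding split[OF ev(1)] split[OF ev(2)] sum_distrib_right
    using mc \<open>x \<in> E\<close> T \<open>s \<ge> 0\<close> \<open>t \<ge> 0\<close> \<open>y \<in> E\<close> \<open>z \<in> E\<close>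
    by (intro sum.cong refl) (auto simp: markov_chain_def)
qed

text \<open>
  Observe the chain at the times \<open>j \<delta>\<close>, killed when it is seen outside \<open>B\<close>, and let \<open>a j\<close> be the
  resulting sub-probability vectors. With \<open>r\<close> the row sums of the resolvent, \<open>(\<alpha> - Q) r = \<alpha>\<close> on \<open>B\<close>,
  and for small \<open>\<delta>\<close> the numbers \<open>b j = a j r\<close> satisfy
  \<open>b (j + 1) \<le> (1 + \<alpha> \<delta>) b j - \<delta> (\<alpha> - \<eta>) p\<close>. If \<open>r x\<close> were much smaller than \<open>p\<close>, this recursion would
  make \<open>b\<close> negative before time \<open>T\<close>. Rational times are used because they form a countable set that
  contains the grid when \<open>\<delta> = T / k\<close>.
\<close>
lemma (in sub_generator) res_row_sum_ge_stay_prob: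
  assumes mc: "markov_chain E M X" and gen: "is_generator E M X Q" and "B \<subseteq> E"
    and "\<alpha> > 0" "x \<in> B" "T > (0::nat)"
  defines "p \<equiv> measure (M x) {w \<in> space (M x). \<forall>t\<in>{0..real T} \<inter> \<rat>. X t w \<in> B}"
  shows "p * (1 - 1 / (1 + \<alpha> * T)) \<le> (\<Sum>y\<in>B. res \<alpha> x y)"
proof -
  define r where "r = (\<lambda>x. \<Sum>y\<in>B. res \<alpha> x y)"
  have "x \<in> E" using assms by auto
  interpret prob_space "M x" using mc \<open>x \<in> E\<close> by (auto simp: markov_chain_def)
  have r0: "0 \<le> r y" if "y \<in> B" for y
    unfolding r_def using \<open>\<alpha> > 0\<close> that by (intro sum_nonneg res_nonneg)
  have r_eq: "(\<Sum>z\<in>B. Q y z * r z) = \<alpha> * r y - \<alpha>" if "y \<in> B" for y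
    using potential_equation[OF \<open>\<alpha> > 0\<close> that, of "\<lambda>_. 1"] by (simp add: r_def)
  have p01: "0 \<le> p" "p \<le> 1" by (auto simp: p_def)
  have approx: "(1 - \<eta> / \<alpha>) * p * (1 - 1 / (1 + \<alpha> * T)) \<le> r x" if \<eta>: "0 < \<eta>" "\<eta> < \<alpha>" for \<eta>
  proof -
    have "\<forall>\<^sub>F \<delta> in at_right 0. \<forall>y\<in>B. (\<Sum>z\<in>B. trans_prob M X \<delta> y z * r z) \<le> r y + \<delta> * (\<alpha> * r y - \<alpha> + \<eta>)"
    proof (rule eventually_ball_finite[OF finite_B], rule ballI)
      fix y assume "y \<in> B"
      have "((\<lambda>\<delta>. \<Sum>z\<in>B. (trans_prob M X \<delta> y z - of_bool (y = z)) / \<delta> * r z)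
              \<longlongrightarrow> (\<Sum>z\<in>B. Q y z * r z)) (at_right 0)"
      proof (intro tendsto_sum tendsto_mult tendsto_const)
        show "((\<lambda>\<delta>. (trans_prob M X \<delta> y z - of_bool (y = z)) / \<delta>) \<longlongrightarrow> Q y z) (at_right 0)" if "z \<in> B" for z
          using gen \<open>y \<in> B\<close> \<open>B \<subseteq> E\<close> that unfolding is_generator_def by blast
      qed
      then have "\<forall>\<^sub>F \<delta> in at_right 0. (\<Sum>z\<in>B. (trans_prob M X \<delta> y z - of_bool (y = z)) / \<delta> * r z)
           < \<alpha> * r y - \<alpha> + \<eta>"
        by (rule order_tendstoD(2)) (use r_eq[OF \<open>y \<in> B\<close>] \<eta> in simp)
      then show "\<forall>\<^sub>F \<delta> in at_right 0. (\<Sum>z\<in>B. trans_prob M X \<delta> y z * r z) \<le> r y + \<delta> * (\<alpha> * r y - \<alpha> + \<eta>)"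
        using eventually_at_right_less[of 0]
      proof eventually_elim
        case (elim \<delta>)
        have "(\<Sum>z\<in>B. trans_prob M X \<delta> y z * r z)
          = (\<Sum>z\<in>B. \<delta> * ((trans_prob M X \<delta> y z - of_bool (y = z)) / \<delta> * r z) + (if y = z then r z else 0))"
          using elim(2) by (intro sum.cong refl) (auto simp: field_simps)
        also have "\<dots> = \<delta> * (\<Sum>z\<in>B. (trans_prob M X \<delta> y z - of_bool (y = z)) / \<delta> * r z) + r y"
          using \<open>y \<in> B\<close> finite_B by (simp add: sum.distrib sum_distrib_left)
        also have "\<dots> \<le> \<delta> * (\<alpha> * r y - \<alpha> + \<eta>) + r y"
          using elim by (intro add_right_mono mult_left_mono) auto
        finally show ?case by simp
      qed
    qed
    then obtain \<delta>0 where \<delta>0: "\<delta>0 > 0" and step: "\<And>\<delta> y. 0 < \<delta> \<Longrightarrow> \<delta> < \<delta>0 \<Longrightarrow> y \<in> B \<Longrightarrow>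
        (\<Sum>z\<in>B. trans_prob M X \<delta> y z * r z) \<le> r y + \<delta> * (\<alpha> * r y - \<alpha> + \<eta>)"
      unfolding eventually_at_right_field by auto
    obtain k where k: "real T / \<delta>0 < real k" using reals_Archimedean2 by blast
    then have "k > 0" using \<open>T > 0\<close> \<delta>0 by (cases k) (auto simp: field_simps)
    define \<delta> where "\<delta> = real T / real k"
    have \<delta>: "0 < \<delta>" "\<delta> < \<delta>0" "real k * \<delta> = real T"
      using k \<delta>0 \<open>k > 0\<close> \<open>T > 0\<close> by (auto simp: \<delta>_def field_simps)
    define a where "a = (\<lambda>j y. measure (M x)
        {w \<in> space (M x). (\<forall>i\<in>(\<lambda>i. real i * \<delta>) ` {..<j}. X i w \<in> B) \<and> X (real j * \<delta>) w = y})"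
    have ev: "{w \<in> space (M x). (\<forall>i\<in>(\<lambda>i. real i * \<delta>) ` {..<j}. X i w \<in> B) \<and> X (real j * \<delta>) w = y} \<in> sets (M x)" for j y
      using \<delta> by (intro sets.sets_Collect_conj sets.sets_Collect_finite_All
          chain_event_sets[OF mc \<open>x \<in> E\<close>] chain_event_sets_eq[OF mc \<open>x \<in> E\<close>]) auto
    have ev2: "{w \<in> space (M x). (\<forall>i\<in>(\<lambda>i. real i * \<delta>) ` {..<j}. X i w \<in> B) \<and> X (real j * \<delta>) w = y \<and> X (real j * \<delta> + \<delta>) w = z} \<in> sets (M x)" for j y z
      using \<delta> by (intro sets.sets_Collect_conj sets.sets_Collect_finite_All
          chain_event_sets[OF mc \<open>x \<in> E\<close>] chain_event_sets_eq[OF mc \<open>x \<in> E\<close>]) auto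
    have a_Suc: "a (Suc j) z = (\<Sum>y\<in>B. a j y * trans_prob M X \<delta> y z)" if "z \<in> B" for j z
    proof -
      let ?A = "\<lambda>y. {w \<in> space (M x). (\<forall>i\<in>(\<lambda>i. real i * \<delta>) ` {..<j}. X i w \<in> B) \<and> X (real j * \<delta>) w = y \<and> X (real j * \<delta> + \<delta>) w = z}"
      have "a (Suc j) z = measure (M x) (\<Union>y\<in>B. ?A y)"
        unfolding a_def by (rule arg_cong[where f = "measure (M x)"])
          (auto simp: less_Suc_eq algebra_simps)
      also have "\<dots> = (\<Sum>y\<in>B. measure (M x) (?A y))"
      proof (rule finite_measure_finite_Union[OF finite_B])
        show "?A ` B \<subseteq> sets (M x)" by (rule image_subsetI) (rule ev2)
      qed (auto simp: disjoint_family_on_def)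
      also have "\<dots> = (\<Sum>y\<in>B. a j y * trans_prob M X \<delta> y z)"
        unfolding a_def using that \<open>B \<subseteq> E\<close> \<delta> \<open>x \<in> E\<close>
        by (intro sum.cong refl markov_step_set[OF mc]) (auto simp: finite_B mult_right_mono)
      finally show ?thesis .
    qed
    have a_sum: "p \<le> (\<Sum>y\<in>B. a j y)" if "j \<le> k" for j
    proof -
      let ?A = "\<lambda>y. {w \<in> space (M x). (\<forall>i\<in>(\<lambda>i. real i * \<delta>) ` {..<j}. X i w \<in> B) \<and> X (real j * \<delta>) w = y}"
      have D: "real i * \<delta> \<in> {0..real T} \<inter> \<rat>" if "i \<le> j" for i
      proof -
        have "real i * \<delta> \<le> real k * \<delta>" using that \<open>j \<le> k\<close> \<delta> by (intro mult_right_mono) auto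
        moreover have "real i * \<delta> \<in> \<rat>" unfolding \<delta>_def by (intro Rats_mult Rats_divide) auto
        ultimately show ?thesis using \<delta> by auto
      qed
      have "p \<le> measure (M x) (\<Union>y\<in>B. ?A y)"
        unfolding p_def
      proof (rule finite_measure_mono)
        show "(\<Union>y\<in>B. ?A y) \<in> sets (M x)" using ev finite_B by auto
        show "{w \<in> space (M x). \<forall>t\<in>{0..real T} \<inter> \<rat>. X t w \<in> B} \<subseteq> (\<Union>y\<in>B. ?A y)"
          using D by (auto simp del: Int_iff)
      qed
      also have "\<dots> = (\<Sum>y\<in>B. a j y)"
        unfolding a_def by (rule finite_measure_finite_Union)
          (use ev finite_B in \<open>auto simp: disjoint_family_on_def\<close>)
      finally show ?thesis .
    qed
    have a0: "a 0 y = of_bool (x = y)" for y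
    proof -
      have "AE w in M x. X 0 w = x" using mc \<open>x \<in> E\<close> by (auto simp: markov_chain_def)
      then have *: "AE w in M x. X 0 w = y \<longleftrightarrow> x = y" by auto
      have "a 0 y = measure (M x) {w \<in> space (M x). x = y}"
        unfolding a_def using * ev[of 0 y] by (intro measure_eq_AE) auto
      then show ?thesis using prob_space by (cases "x = y") simp_all
    qed
    define b where "b = (\<lambda>j. \<Sum>y\<in>B. a j y * r y)"
    \<comment> \<open>The fixed point of the affine recursion for \<open>b\<close>.\<close>
    define q where "q = (1 - \<eta> / \<alpha>) * p"
    have b_Suc: "b (Suc j) - q \<le> (1 + \<alpha> * \<delta>) * (b j - q)" if "j \<le> k" for j
    proof -
      have "b (Suc j) = (\<Sum>y\<in>B. a j y * (\<Sum>z\<in>B. trans_prob M X \<delta> y z * r z))"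
        unfolding b_def by (simp add: a_Suc sum_distrib_left sum_distrib_right mult.assoc) (rule sum.swap)
      also have "\<dots> \<le> (\<Sum>y\<in>B. a j y * (r y + \<delta> * (\<alpha> * r y - \<alpha> + \<eta>)))"
        using \<delta> by (intro sum_mono mult_left_mono step) (auto simp: a_def)
      also have "\<dots> = (\<Sum>y\<in>B. (1 + \<alpha> * \<delta>) * (a j y * r y) - \<delta> * (\<alpha> - \<eta>) * a j y)"
        by (intro sum.cong refl) (simp add: algebra_simps)
      also have "\<dots> = (1 + \<alpha> * \<delta>) * b j - \<delta> * (\<alpha> - \<eta>) * (\<Sum>y\<in>B. a j y)"
        by (simp add: b_def sum_subtractf sum_distrib_left)
      also have "\<dots> \<le> (1 + \<alpha> * \<delta>) * b j - \<delta> * (\<alpha> - \<eta>) * p"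
        using a_sum[OF that] \<delta> \<eta> by (intro diff_left_mono mult_left_mono) auto
      also have "\<delta> * (\<alpha> - \<eta>) * p = \<alpha> * \<delta> * q"
        using \<open>\<alpha> > 0\<close> by (simp add: q_def field_simps)
      finally show ?thesis by (simp add: algebra_simps)
    qed
    have b_bound: "b j - q \<le> (1 + \<alpha> * \<delta>) ^ j * (r x - q)" if "j \<le> k" for j
      using that
    proof (induction j)
      case 0
      then show ?case using \<open>x \<in> B\<close> finite_B by (simp add: b_def a0 of_bool_def if_distrib[of "\<lambda>u. u * _"] sum.delta cong: if_cong)
    next
      case (Suc j)
      have "b (Suc j) - q \<le> (1 + \<alpha> * \<delta>) * (b j - q)" using Suc.prems by (intro b_Suc) auto
      also have "\<dots> \<le> (1 + \<alpha> * \<delta>) * ((1 + \<alpha> * \<delta>) ^ j * (r x - q))"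
        using Suc \<open>\<alpha> > 0\<close> \<delta> by (intro mult_left_mono) auto
      finally show ?case by (simp add: mult.assoc)
    qed
    have "0 \<le> b k"
      unfolding b_def using r0 by (intro sum_nonneg mult_nonneg_nonneg) (auto simp: a_def)
    then have main: "- q \<le> (1 + \<alpha> * \<delta>) ^ k * (r x - q)"
      using b_bound[of k] by simp
    have "real k * (\<alpha> * \<delta>) = \<alpha> * T"
      unfolding \<delta>(3)[symmetric] by (simp add: mult_ac)
    moreover have "1 + real k * (\<alpha> * \<delta>) \<le> (1 + \<alpha> * \<delta>) ^ k"
    proof (rule Bernoulli_inequality)
      have "0 \<le> \<alpha> * \<delta>" using \<open>\<alpha> > 0\<close> \<delta> by simp
      then show "- 1 \<le> \<alpha> * \<delta>" by linarith
    qed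
    ultimately have bern: "1 + \<alpha> * T \<le> (1 + \<alpha> * \<delta>) ^ k"
      by (simp only:)
    have "q \<ge> 0" using \<eta> p01 by (simp add: q_def)
    have "0 < 1 + \<alpha> * T" using \<open>\<alpha> > 0\<close> by (simp add: add_pos_nonneg)
    show ?thesis
    proof (cases "q \<le> r x")
      case True
      have "q * (1 - 1 / (1 + \<alpha> * T)) \<le> q * 1"
        using \<open>q \<ge> 0\<close> \<open>0 < 1 + \<alpha> * T\<close> by (intro mult_left_mono) auto
      then show ?thesis using True by (simp add: q_def)
    next
      case False
      have "- q \<le> (1 + \<alpha> * T) * (r x - q)"
        using main bern False by (smt (verit) mult_right_mono_neg)
      then have "q * (1 - 1 / (1 + \<alpha> * T)) \<le> r x"
        using \<open>0 < 1 + \<alpha> * T\<close> by (simp add: field_simps)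
      then show ?thesis by (simp add: q_def)
    qed
  qed
  have "((\<lambda>\<eta>. (1 - \<eta> / \<alpha>) * p * (1 - 1 / (1 + \<alpha> * T))) \<longlongrightarrow> (1 - 0 / \<alpha>) * p * (1 - 1 / (1 + \<alpha> * T))) (at_right 0)"
    by (intro tendsto_intros) (use \<open>\<alpha> > 0\<close> in auto)
  moreover have "\<forall>\<^sub>F \<eta> in at_right 0. (1 - \<eta> / \<alpha>) * p * (1 - 1 / (1 + \<alpha> * T)) \<le> r x"
    unfolding eventually_at_right_field using \<open>\<alpha> > 0\<close> approx by blast
  ultimately have "(1 - 0 / \<alpha>) * p * (1 - 1 / (1 + \<alpha> * T)) \<le> r x"
    by (intro tendsto_upperbound) auto
  then show ?thesis by (simp add: r_def)
qed

lemma stay_prob_tendsto_1: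
  assumes chain: "regular_jump_chain (state_space S) M X" and "x \<in> state_space S" and "T \<ge> (0::real)"
  shows "(\<lambda>m. measure (M x) {w \<in> space (M x). \<forall>t\<in>{0..T} \<inter> \<rat>. X t w \<in> levels_upto S m}) \<longlonglongrightarrow> 1"
proof -
  have mc: "markov_chain (state_space S) M X" using chain by (simp add: regular_jump_chain_def)
  interpret prob_space "M x" using mc assms by (auto simp: markov_chain_def)
  let ?A = "\<lambda>m. {w \<in> space (M x). \<forall>t\<in>{0..T} \<inter> \<rat>. X t w \<in> levels_upto S m}"
  have sets: "?A m \<in> sets (M x)" for m
  proof (rule sets.sets_Collect_countable_All')
    show "countable ({0..T} \<inter> \<rat>)" using countable_rat by auto
  qed (use chain_event_sets[OF mc \<open>x \<in> _\<close>] in auto)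
  have "(\<lambda>m. measure (M x) (?A m)) \<longlonglongrightarrow> measure (M x) (\<Union>m. ?A m)"
  proof (rule finite_Lim_measure_incseq)
    show "range ?A \<subseteq> sets (M x)" by (rule image_subsetI) (rule sets)
    show "incseq ?A" unfolding incseq_def using mono_levels_upto[of _ _ S] by blast
  qed
  moreover have "AE w in M x. w \<in> (\<Union>m. ?A m)"
  proof -
    have "AE w in M x. regular_jump_path (\<lambda>t. X t w)"
      using chain assms by (auto simp: regular_jump_chain_def)
    then show ?thesis
    proof (rule AE_mp, intro AE_I2 impI)
      fix w assume w: "w \<in> space (M x)" "regular_jump_path (\<lambda>t. X t w)"
      obtain m where m: "\<forall>t\<in>{0..T}. fst (X t w) \<le> m"
        using regular_jump_path_bounded_level[OF w(2) \<open>T \<ge> 0\<close>] by auto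
      have "X t w \<in> state_space S" if "t \<ge> 0" for t
        using mc assms(2) that w(1) measurable_space[of "X t" "M x" "count_space (state_space S)" w]
        by (auto simp: markov_chain_def)
      then have "w \<in> ?A m" using m w(1) by (fastforce simp: levels_upto_def state_space_def)
      then show "w \<in> (\<Union>m. ?A m)" by blast
    qed
  qed
  then have "measure (M x) (\<Union>m. ?A m) = 1"
    using sets by (intro prob_eq_1[THEN iffD2]) auto
  ultimately show ?thesis by simp
qed

section \<open>Generators on the level structure and their stationary distributions\<close>

lemma level_sums_tendsto:
  assumes "(f has_sum s) (state_space S)"
  shows "(\<lambda>m. sum f (levels_upto S m)) \<longlonglongrightarrow> s"
proof (rule filterlim_compose[OF assms[unfolded has_sum_def]], unfold filterlim_finite_subsets_at_top, intro allI impI)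
  fix A assume A: "finite A \<and> A \<subseteq> state_space S"
  then obtain k where k: "\<And>x. x \<in> A \<Longrightarrow> fst x \<le> k"
    using finite_nat_set_iff_bounded_le[of "fst ` A"] by auto
  show "\<forall>\<^sub>F m in sequentially. finite (levels_upto S m) \<and> A \<subseteq> levels_upto S m \<and> levels_upto S m \<subseteq> state_space S"
    using eventually_ge_at_top[of k]
  proof eventually_elim
    case (elim m)
    have "x \<in> levels_upto S m" if "x \<in> A" for x
      using state_in_levels_upto[of x S] mono_levels_upto[of "fst x" m S] k[OF that] elim A that by auto
    then show ?case by (auto simp: finite_levels_upto levels_upto_subset)
  qed
qed

lemma level_sum_le_has_sum:
  fixes f :: "state \<Rightarrow> real"
  assumes "(f has_sum s) (state_space S)" "\<And>x. x \<in> state_space S \<Longrightarrow> 0 \<le> f x"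
  shows "sum f (levels_upto S m) \<le> s"
  by (rule finite_sum_le_has_sum[OF assms(1) finite_levels_upto levels_upto_subset]) (use assms(2) in blast)

locale skip_free_generator =
  fixes S :: "nat \<Rightarrow> nat" and Q :: "state \<Rightarrow> state \<Rightarrow> real"
  assumes off_diagonal: "\<And>x y. x \<in> state_space S \<Longrightarrow> y \<in> state_space S \<Longrightarrow> x \<noteq> y \<Longrightarrow> 0 \<le> Q x y"
    and conservative: "conservative (state_space S) Q"
    and skip_free: "\<And>x y. x \<in> state_space S \<Longrightarrow> y \<in> state_space S \<Longrightarrow> fst x + 2 \<le> fst y \<Longrightarrow> Q x y = 0"
begin

abbreviation E where "E \<equiv> state_space S"
abbreviation F where "F \<equiv> levels_upto S"
abbreviation R where "R \<equiv> trunc_resolvent S Q"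

lemma F_E: "x \<in> F m \<Longrightarrow> x \<in> E"
  using levels_upto_subset by blast

lemma F_mono: "m \<le> n \<Longrightarrow> x \<in> F m \<Longrightarrow> x \<in> F n"
  using mono_levels_upto by blast

lemma eventually_in_F: "x \<in> E \<Longrightarrow> \<forall>\<^sub>F m in sequentially. x \<in> F m"
  by (rule eventually_mono[OF eventually_ge_at_top[of "fst x"]])
    (rule F_mono, assumption, rule state_in_levels_upto)

sublocale trunc: sub_generator "levels_upto S m" Q for m
proof
  show "(\<Sum>y\<in>F m. Q x y) \<le> 0" if "x \<in> F m" for x
  proof (rule finite_sum_le_has_sum[OF _ finite_levels_upto levels_upto_subset])
    show "(Q x has_sum 0) E" using conservative F_E[OF that] by (simp add: conservative_def)
    show "0 \<le> Q x y" if "y \<in> E - F m" for y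
      using that \<open>x \<in> F m\<close> F_E by (intro off_diagonal) auto
  qed
qed (auto simp: finite_levels_upto intro: off_diagonal F_E)

lemma R_eq: "R \<alpha> m = trunc.res m \<alpha>"
  by (simp add: trunc_resolvent_def trunc.res_def)

lemma R_nonneg: "\<alpha> > 0 \<Longrightarrow> x \<in> F m \<Longrightarrow> y \<in> F m \<Longrightarrow> 0 \<le> R \<alpha> m x y"
  by (simp add: R_eq trunc.res_nonneg)

lemma Q_zero_beyond: "x \<in> F m \<Longrightarrow> y \<in> E \<Longrightarrow> y \<notin> F (Suc m) \<Longrightarrow> Q x y = 0"
  by (rule skip_free) (auto simp: levels_upto_def state_space_def)

lemma row_has_sum:
  assumes "x \<in> F m"
  shows "((\<lambda>y. Q x y * u y) has_sum (\<Sum>y\<in>F (Suc m). Q x y * u y)) E"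
proof -
  have "((\<lambda>y. Q x y * u y) has_sum s) E \<longleftrightarrow> ((\<lambda>y. Q x y * u y) has_sum s) (F (Suc m))" for s
    using Q_zero_beyond[OF assms] F_E by (intro has_sum_cong_neutral) auto
  then show ?thesis using finite_levels_upto by simp
qed

lemma row_sum_zero:
  assumes "x \<in> F m"
  shows "(\<Sum>y\<in>F (Suc m). Q x y) = 0"
  using row_has_sum[OF assms, of "\<lambda>_. 1"] conservative F_E[OF assms]
  by (auto simp: conservative_def dest: has_sum_unique)

lemma row_sum_mono:
  assumes "x \<in> F m" "\<And>y. y \<in> E \<Longrightarrow> 0 \<le> u y"
  shows "(\<Sum>y\<in>F m. Q x y * u y) \<le> (\<Sum>y\<in>F (Suc m). Q x y * u y)"
proof (rule sum_mono2[OF finite_levels_upto])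
  show "F m \<subseteq> F (Suc m)" by (rule mono_levels_upto) simp
  show "0 \<le> Q x y * u y" if "y \<in> F (Suc m) - F m" for y
  proof -
    have "x \<in> E" "y \<in> E" "x \<noteq> y" using that assms(1) F_E by blast+
    then show ?thesis by (intro mult_nonneg_nonneg off_diagonal assms(2))
  qed
qed

end

text \<open>
  The assumption \<open>honest\<close> is the analytic form of non-explosion: the chain killed on leaving the levels
  up to \<open>m\<close> survives an exponential time of rate \<open>\<alpha>\<close> with probability tending to one.
\<close>
locale stationary_generator = skip_free_generator +
  fixes p :: "state \<Rightarrow> real"
  assumes stationary: "stationary_distribution (state_space S) Q p"
    and honest: "\<And>\<alpha> x. \<alpha> > 0 \<Longrightarrow> x \<in> state_space S \<Longrightarrow>
      (\<lambda>m. \<Sum>y\<in>levels_upto S m. trunc_resolvent S Q \<alpha> m x y) \<longlonglongrightarrow> 1"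
begin

lemma p_nonneg: "x \<in> E \<Longrightarrow> 0 \<le> p x"
  using stationary by (simp add: stationary_distribution_def)

lemma p_sum: "(p has_sum 1) E"
  using stationary by (simp add: stationary_distribution_def)

lemma p_tendsto: "(\<lambda>m. sum p (F m)) \<longlonglongrightarrow> 1"
  by (rule level_sums_tendsto[OF p_sum])

lemma p_level_le: "sum p (F m) \<le> 1"
  by (rule level_sum_le_has_sum[OF p_sum p_nonneg])

text \<open>
  The law, under the initial distribution \<open>p\<close>, of the chain killed on leaving the levels up to \<open>m\<close>,
  observed at an independent exponential time of rate \<open>\<alpha>\<close>.
\<close>
definition occ :: "real \<Rightarrow> nat \<Rightarrow> state \<Rightarrow> real" where
  "occ \<alpha> m y = (\<Sum>x\<in>F m. p x * R \<alpha> m x y)"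

lemma occ_nonneg: "\<alpha> > 0 \<Longrightarrow> y \<in> F m \<Longrightarrow> 0 \<le> occ \<alpha> m y"
  unfolding occ_def by (intro sum_nonneg mult_nonneg_nonneg p_nonneg R_nonneg F_E)

text \<open>
  Restricting \<open>p\<close> to the levels up to \<open>m\<close> drops only inflow from above, so the restriction times
  \<open>\<alpha> - Q_m\<close> is at least \<open>\<alpha> p\<close>. Multiplying by the nonnegative resolvent gives the claim.
\<close>
lemma occ_le:
  assumes "\<alpha> > 0" "y \<in> F m"
  shows "occ \<alpha> m y \<le> p y"
proof -
  have col: "(\<Sum>x\<in>F m. p x * Q x z) \<le> 0" if "z \<in> F m" for z
  proof (rule finite_sum_le_has_sum[OF _ finite_levels_upto levels_upto_subset])
    show "((\<lambda>x. p x * Q x z) has_sum 0) E"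
      using stationary F_E[OF that] by (simp add: stationary_distribution_def)
    show "0 \<le> p x * Q x z" if "x \<in> E - F m" for x
      using that \<open>z \<in> F m\<close> F_E by (intro mult_nonneg_nonneg p_nonneg off_diagonal) auto
  qed
  have "\<alpha> * p y = (\<Sum>x\<in>F m. if x = y then \<alpha> * p x else 0)"
    using assms finite_levels_upto by simp
  also have "\<dots> = (\<Sum>x\<in>F m. p x * (\<alpha> * R \<alpha> m x y - (\<Sum>z\<in>F m. Q x z * R \<alpha> m z y)))"
    using assms by (intro sum.cong refl) (simp add: R_eq trunc.res_equation)
  also have "\<dots> = \<alpha> * occ \<alpha> m y - (\<Sum>x\<in>F m. \<Sum>z\<in>F m. p x * Q x z * R \<alpha> m z y)"
    by (simp add: occ_def right_diff_distrib sum_subtractf sum_distrib_left mult.assoc mult.left_commute)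
  also have "(\<Sum>x\<in>F m. \<Sum>z\<in>F m. p x * Q x z * R \<alpha> m z y) = (\<Sum>z\<in>F m. (\<Sum>x\<in>F m. p x * Q x z) * R \<alpha> m z y)"
    by (subst sum.swap) (simp add: sum_distrib_right)
  finally have "\<alpha> * p y = \<alpha> * occ \<alpha> m y - (\<Sum>z\<in>F m. (\<Sum>x\<in>F m. p x * Q x z) * R \<alpha> m z y)" .
  moreover have "(\<Sum>z\<in>F m. (\<Sum>x\<in>F m. p x * Q x z) * R \<alpha> m z y) \<le> 0"
    using assms by (intro sum_nonpos mult_nonpos_nonneg col R_nonneg)
  ultimately have "\<alpha> * occ \<alpha> m y \<le> \<alpha> * p y" by linarith
  then show ?thesis using assms by simp
qed

lemma occ_sum: "(\<Sum>y\<in>F m. occ \<alpha> m y * h y) = (\<Sum>x\<in>F m. p x * (\<Sum>y\<in>F m. R \<alpha> m x y * h y))"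
  unfolding occ_def sum_distrib_right sum_distrib_left
  by (subst sum.swap) (simp add: mult.assoc)

lemma occ_mass_tendsto:
  assumes "\<alpha> > 0"
  shows "(\<lambda>m. \<Sum>x\<in>F m. p x * (\<Sum>y\<in>F m. R \<alpha> m x y)) \<longlonglongrightarrow> 1"
proof (rule order_tendstoI)
  let ?r = "\<lambda>m x. \<Sum>y\<in>F m. R \<alpha> m x y"
  have up: "(\<Sum>x\<in>F m. p x * ?r m x) \<le> 1" for m
  proof -
    have "(\<Sum>x\<in>F m. p x * ?r m x) \<le> (\<Sum>x\<in>F m. p x * 1)"
      by (intro sum_mono mult_left_mono) (auto simp: R_eq intro!: trunc.res_row_sum_le_1 assms p_nonneg F_E)
    then show ?thesis using p_level_le[of m] by simp
  qed
  show "\<forall>\<^sub>F m in sequentially. (\<Sum>x\<in>F m. p x * ?r m x) < a" if "1 < a" for a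
    using up that by (intro always_eventually) (auto intro: le_less_trans)
  show "\<forall>\<^sub>F m in sequentially. a < (\<Sum>x\<in>F m. p x * ?r m x)" if "a < 1" for a
  proof -
    obtain i where i: "a < sum p (F i)"
      using order_tendstoD(1)[OF p_tendsto \<open>a < 1\<close>] by (auto simp: eventually_sequentially)
    have "(\<lambda>m. \<Sum>x\<in>F i. p x * ?r m x) \<longlonglongrightarrow> (\<Sum>x\<in>F i. p x * 1)"
      by (intro tendsto_sum tendsto_mult tendsto_const honest assms F_E)
    then have "\<forall>\<^sub>F m in sequentially. a < (\<Sum>x\<in>F i. p x * ?r m x)"
      using i by (auto dest: order_tendstoD)
    then show ?thesis
      using eventually_ge_at_top[of i]
    proof eventually_elim
      case (elim m)
      have "(\<Sum>x\<in>F i. p x * ?r m x) \<le> (\<Sum>x\<in>F m. p x * ?r m x)"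
        using elim(2) assms
        by (intro sum_mono2 finite_levels_upto mono_levels_upto)
          (auto intro!: mult_nonneg_nonneg p_nonneg sum_nonneg R_nonneg intro: F_E)
      then show ?case using elim(1) by linarith
    qed
  qed
qed

text \<open>
  The defect \<open>p - occ\<close> is nonnegative, and its total mass tends to zero.
\<close>
lemma occ_tendsto:
  assumes "\<alpha> > 0" "y \<in> E"
  shows "(\<lambda>m. occ \<alpha> m y) \<longlonglongrightarrow> p y"
proof -
  let ?d = "\<lambda>m. sum p (F m) - (\<Sum>x\<in>F m. p x * (\<Sum>y\<in>F m. R \<alpha> m x y))"
  have lim: "?d \<longlonglongrightarrow> 0"
    using tendsto_diff[OF p_tendsto occ_mass_tendsto[OF assms(1)]] by (simp only: diff_self)
  have "\<forall>\<^sub>F m in sequentially. norm (p y - occ \<alpha> m y) \<le> ?d m"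
    using eventually_in_F[OF assms(2)]
  proof eventually_elim
    case (elim m)
    have "p y - occ \<alpha> m y \<le> (\<Sum>x\<in>F m. p x - occ \<alpha> m x)"
      using elim assms occ_le
      by (intro member_le_sum[where f = "\<lambda>y. p y - occ \<alpha> m y"] finite_levels_upto) auto
    then show ?case
      using occ_sum[of \<alpha> m "\<lambda>_. 1"] occ_le[OF assms(1) elim] by (simp add: sum_subtractf)
  qed
  then have "(\<lambda>m. p y - occ \<alpha> m y) \<longlonglongrightarrow> 0"
    by (rule Lim_null_comparison[OF _ lim])
  from tendsto_diff[OF tendsto_const[of "p y"] this] show ?thesis by simp
qed

lemma occ_weighted_tendsto:
  assumes "\<alpha> > 0" and w: "\<And>x. x \<in> E \<Longrightarrow> 0 \<le> w x" and s: "((\<lambda>x. p x * w x) has_sum s) E"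
  shows "(\<lambda>m. \<Sum>y\<in>F m. (p y - occ \<alpha> m y) * w y) \<longlonglongrightarrow> 0"
proof (rule order_tendstoI)
  let ?d = "\<lambda>m y. (p y - occ \<alpha> m y) * w y"
  have nn: "0 \<le> ?d m y" if "y \<in> F m" for m y
    using occ_le[OF \<open>\<alpha> > 0\<close> that] w[OF F_E[OF that]] by simp
  show "\<forall>\<^sub>F m in sequentially. a < (\<Sum>y\<in>F m. ?d m y)" if "a < 0" for a
    using that nn by (intro always_eventually allI) (meson less_le_trans sum_nonneg)
  show "\<forall>\<^sub>F m in sequentially. (\<Sum>y\<in>F m. ?d m y) < a" if "0 < a" for a
  proof -
    have tail: "(\<Sum>y\<in>F m. p y * w y) \<le> s" for m
      by (rule level_sum_le_has_sum[OF s]) (use p_nonneg w in auto)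
    have "\<forall>\<^sub>F i in sequentially. s - a / 2 < (\<Sum>y\<in>F i. p y * w y)"
      by (rule order_tendstoD(1)[OF level_sums_tendsto[OF s]]) (use that in auto)
    then obtain i where i: "s - a / 2 < (\<Sum>y\<in>F i. p y * w y)"
      by (auto simp: eventually_sequentially)
    have "(\<lambda>m. \<Sum>y\<in>F i. ?d m y) \<longlonglongrightarrow> (\<Sum>y\<in>F i. (p y - p y) * w y)"
      by (intro tendsto_sum tendsto_mult tendsto_diff tendsto_const occ_tendsto \<open>\<alpha> > 0\<close> F_E)
    then have "\<forall>\<^sub>F m in sequentially. (\<Sum>y\<in>F i. ?d m y) < a / 2"
      by (rule order_tendstoD(2)) (use that in simp)
    then show ?thesis
      using eventually_ge_at_top[of i]
    proof eventually_elim
      case (elim m)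
      have sub: "F i \<subseteq> F m" using elim(2) by (rule mono_levels_upto)
      have "(\<Sum>y\<in>F m. ?d m y) = (\<Sum>y\<in>F m - F i. ?d m y) + (\<Sum>y\<in>F i. ?d m y)"
        by (rule sum.subset_diff[OF sub finite_levels_upto])
      also have "(\<Sum>y\<in>F m - F i. ?d m y) \<le> (\<Sum>y\<in>F m - F i. p y * w y)"
        using occ_nonneg[OF \<open>\<alpha> > 0\<close>] w F_E by (intro sum_mono) (auto simp: left_diff_distrib)
      also have "(\<Sum>y\<in>F m - F i. p y * w y) = (\<Sum>y\<in>F m. p y * w y) - (\<Sum>y\<in>F i. p y * w y)"
        by (simp add: sum_diff[OF finite_levels_upto sub])
      finally show ?case using elim(1) i tail[of m] by linarith
    qed
  qed
qed

end

section \<open>Consequences of the drift condition\<close>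

locale drift_generator = stationary_generator +
  fixes v :: "state \<Rightarrow> real" and b c :: real and K :: nat
  assumes b_pos: "b > 0" and c_pos: "c > 0"
    and v_ge: "\<And>x. x \<in> state_space S \<Longrightarrow> v x \<ge> 1 / c"
    and drift: "\<And>x. x \<in> state_space S \<Longrightarrow>
          (\<Sum>\<^sub>\<infinity>y\<in>state_space S. Q x y * v y) \<le> - c * v x + b * indicator (levels_upto S K) x"
begin

lemma v_pos: "x \<in> E \<Longrightarrow> 0 < v x"
  using v_ge c_pos by (meson less_le_trans zero_less_divide_1_iff)

lemma cv_ge_1: "x \<in> E \<Longrightarrow> 1 \<le> c * v x"
  using v_ge[of x] c_pos by (simp add: field_simps)

lemma drift_next:
  assumes "x \<in> F m"
  shows "(\<Sum>y\<in>F (Suc m). Q x y * v y) \<le> - c * v x + b * indicator (F K) x"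
  using drift[OF F_E[OF assms]] infsumI[OF row_has_sum[OF assms, of v]] by simp

lemma drift_level:
  assumes "x \<in> F m"
  shows "(\<Sum>y\<in>F m. Q x y * v y) \<le> - c * v x + b * indicator (F K) x"
  using row_sum_mono[OF assms, of v] drift_next[OF assms] v_pos by fastforce

text \<open>
  By the drift condition and the minimum principle, \<open>\<alpha> v + b\<close> lies above the solution of
  \<open>(\<alpha> - Q_m) u = \<alpha> c v\<close>.
\<close>
lemma potential_drift_bound:
  assumes "\<alpha> > 0" "x \<in> F m" "j \<le> m"
  shows "(\<Sum>y\<in>F j. R \<alpha> m x y * (c * v y)) \<le> \<alpha> * v x + b"
proof -
  let ?g = "\<lambda>x. \<Sum>y\<in>F m. R \<alpha> m x y * (c * v y)"
  have "(\<Sum>y\<in>F j. R \<alpha> m x y * (c * v y)) \<le> ?g x"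
    using assms c_pos v_pos[OF F_E]
    by (intro sum_mono2 finite_levels_upto mono_levels_upto)
      (auto intro!: mult_nonneg_nonneg R_nonneg simp: less_imp_le)
  moreover have "0 \<le> \<alpha> * v x + b - ?g x"
  proof (rule trunc.min_principle[OF \<open>\<alpha> > 0\<close>, of "F m"])
    fix x assume x: "x \<in> F m"
    have g: "\<alpha> * ?g x - (\<Sum>y\<in>F m. Q x y * ?g y) = \<alpha> * (c * v x)"
      unfolding R_eq by (rule trunc.potential_equation[OF \<open>\<alpha> > 0\<close> x])
    have s: "(\<Sum>y\<in>F m. Q x y * (\<alpha> * v y + b - ?g y))
        = \<alpha> * (\<Sum>y\<in>F m. Q x y * v y) + b * (\<Sum>y\<in>F m. Q x y) - (\<Sum>y\<in>F m. Q x y * ?g y)"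
      by (simp add: algebra_simps sum.distrib sum_subtractf sum_distrib_left)
    have "\<alpha> * (\<Sum>y\<in>F m. Q x y * v y) \<le> \<alpha> * (- c * v x + b * indicator (F K) x)"
      using drift_level[OF x] \<open>\<alpha> > 0\<close> by (intro mult_left_mono) auto
    moreover have "b * (\<Sum>y\<in>F m. Q x y) \<le> 0"
      using trunc.row_sum_nonpos[OF x] b_pos by (intro mult_nonneg_nonpos) auto
    moreover have "\<alpha> * (b * indicator (F K) x) \<le> \<alpha> * b"
      using \<open>\<alpha> > 0\<close> b_pos by (intro mult_left_mono) (auto simp: indicator_def)
    moreover have "0 \<le> \<alpha> * (\<alpha> * v x)"
      using \<open>\<alpha> > 0\<close> v_pos[OF F_E[OF x]] by simp
    ultimately show "0 \<le> \<alpha> * (\<alpha> * v x + b - ?g x) - (\<Sum>y\<in>F m. Q x y * (\<alpha> * v y + b - ?g y))"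
      unfolding s using g by (simp add: algebra_simps)
  qed (use assms in auto)
  ultimately show ?thesis by linarith
qed

text \<open>
  Formally \<open>0 = p Q v \<le> - c p v + b\<close>, but \<open>p Q v\<close> need not converge. Instead integrate
  \<open>potential_drift_bound\<close> against \<open>p\<close>: on the levels up to \<open>i\<close> the bound \<open>\<alpha> v + b\<close> is used, beyond them
  the crude bound \<open>L\<close>. The limits \<open>m \<longlongrightarrow> \<infinity>\<close>, \<open>\<alpha> \<longlongrightarrow> 0\<close>, \<open>i \<longlongrightarrow> \<infinity>\<close>, in this order, leave only \<open>b\<close>.
\<close>
lemma p_drift_bound: "(\<Sum>y\<in>F j. p y * (c * v y)) \<le> b"
proof -
  define L where "L = (\<Sum>y\<in>F j. c * v y)"
  have L0: "0 \<le> L" unfolding L_def using c_pos v_pos[OF F_E] by (intro sum_nonneg) (simp add: less_imp_le)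
  have fixed: "(\<Sum>y\<in>F j. p y * (c * v y)) \<le> \<alpha> * (\<Sum>x\<in>F i. p x * v x) + b + L * (1 - sum p (F i))"
    if "\<alpha> > 0" for \<alpha> i
  proof (rule tendsto_upperbound)
    show "(\<lambda>m. \<Sum>y\<in>F j. occ \<alpha> m y * (c * v y)) \<longlonglongrightarrow> (\<Sum>y\<in>F j. p y * (c * v y))"
      by (intro tendsto_sum tendsto_mult tendsto_const occ_tendsto that F_E)
    show "\<forall>\<^sub>F m in sequentially. (\<Sum>y\<in>F j. occ \<alpha> m y * (c * v y))
        \<le> \<alpha> * (\<Sum>x\<in>F i. p x * v x) + b + L * (1 - sum p (F i))"
      using eventually_ge_at_top[of "max i j"]
    proof eventually_elim
      case (elim m)
      then have sub: "F i \<subseteq> F m" "F j \<subseteq> F m" by (auto intro!: mono_levels_upto)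
      let ?g = "\<lambda>x. \<Sum>y\<in>F j. R \<alpha> m x y * (c * v y)"
      have "(\<Sum>y\<in>F j. occ \<alpha> m y * (c * v y)) = (\<Sum>x\<in>F m. p x * ?g x)"
        unfolding occ_def sum_distrib_right sum_distrib_left
        by (subst sum.swap) (simp add: mult.assoc)
      also have "\<dots> = (\<Sum>x\<in>F m - F i. p x * ?g x) + (\<Sum>x\<in>F i. p x * ?g x)"
        by (rule sum.subset_diff[OF sub(1) finite_levels_upto])
      also have "(\<Sum>x\<in>F m - F i. p x * ?g x) \<le> (\<Sum>x\<in>F m - F i. p x * L)"
      proof (intro sum_mono mult_left_mono)
        fix x assume x: "x \<in> F m - F i"
        show "?g x \<le> L"
          unfolding L_def
        proof (rule sum_mono)
          fix y assume y: "y \<in> F j"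
          have "R \<alpha> m x y \<le> 1"
            using x y sub \<open>\<alpha> > 0\<close> by (simp add: R_eq subsetD trunc.res_le_1)
          then show "R \<alpha> m x y * (c * v y) \<le> c * v y"
            using c_pos v_pos[OF F_E[OF y]] by (simp add: mult_left_le_one_le mult.commute mult_left_le)
        qed
      qed (use p_nonneg F_E in auto)
      also have "\<dots> = L * (sum p (F m) - sum p (F i))"
        by (simp add: sum_diff[OF finite_levels_upto sub(1), symmetric] sum_distrib_right[symmetric])
      also have "\<dots> \<le> L * (1 - sum p (F i))"
        using L0 p_level_le[of m] by (intro mult_left_mono) auto
      also have "(\<Sum>x\<in>F i. p x * ?g x) \<le> (\<Sum>x\<in>F i. p x * (\<alpha> * v x + b))"
        using elim sub by (intro sum_mono mult_left_mono potential_drift_bound that p_nonneg) (auto intro: F_E)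
      also have "\<dots> = \<alpha> * (\<Sum>x\<in>F i. p x * v x) + b * sum p (F i)"
        by (simp add: algebra_simps sum.distrib sum_distrib_left)
      also have "b * sum p (F i) \<le> b * 1"
        using b_pos p_level_le by (intro mult_left_mono) auto
      finally show ?case by simp
    qed
  qed simp
  have lim_\<alpha>: "(\<Sum>y\<in>F j. p y * (c * v y)) \<le> 0 * (\<Sum>x\<in>F i. p x * v x) + b + L * (1 - sum p (F i))" for i
  proof (rule tendsto_lowerbound)
    show "((\<lambda>\<alpha>. \<alpha> * (\<Sum>x\<in>F i. p x * v x) + b + L * (1 - sum p (F i)))
        \<longlongrightarrow> 0 * (\<Sum>x\<in>F i. p x * v x) + b + L * (1 - sum p (F i))) (at_right 0)"
      by (intro tendsto_intros)
    show "\<forall>\<^sub>F \<alpha> in at_right 0. (\<Sum>y\<in>F j. p y * (c * v y))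
        \<le> \<alpha> * (\<Sum>x\<in>F i. p x * v x) + b + L * (1 - sum p (F i))"
      using eventually_at_right_less[of 0] by eventually_elim (rule fixed)
  qed simp
  have "(\<Sum>y\<in>F j. p y * (c * v y)) \<le> b + L * (1 - 1)"
  proof (rule tendsto_lowerbound)
    show "(\<lambda>i. b + L * (1 - sum p (F i))) \<longlonglongrightarrow> b + L * (1 - 1)"
      by (intro tendsto_intros p_tendsto)
  qed (use lim_\<alpha> in auto)
  then show ?thesis by simp
qed

lemma p_v_summable: "(\<lambda>x. p x * v x) summable_on E"
proof (rule nonneg_bdd_above_summable_on)
  show "bdd_above (sum (\<lambda>x. p x * v x) ` {A. A \<subseteq> E \<and> finite A})"
  proof (rule bdd_aboveI2)
    fix A assume A: "A \<in> {A. A \<subseteq> E \<and> finite A}"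
    have "\<forall>\<^sub>F m in sequentially. \<forall>x\<in>A. x \<in> F m"
      using A eventually_in_F by (intro eventually_ball_finite) auto
    then obtain m where m: "A \<subseteq> F m" by (auto simp: eventually_sequentially)
    have "(\<Sum>x\<in>A. p x * v x) \<le> (\<Sum>x\<in>F m. p x * v x)"
      using m by (intro sum_mono2 finite_levels_upto mult_nonneg_nonneg p_nonneg less_imp_le[OF v_pos] F_E) auto
    also have "\<dots> \<le> b / c"
      using p_drift_bound[of m] c_pos by (simp add: field_simps sum_distrib_left)
    finally show "sum (\<lambda>x. p x * v x) A \<le> b / c" .
  qed
qed (auto intro!: mult_nonneg_nonneg p_nonneg less_imp_le[OF v_pos])

text \<open>
  The solution of \<open>(\<alpha> - Q_m) f = h\<close>; the resolvent kernels carry an extra factor \<open>\<alpha>\<close>, which is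
  divided out.
\<close>
definition pot :: "real \<Rightarrow> nat \<Rightarrow> (state \<Rightarrow> real) \<Rightarrow> state \<Rightarrow> real" where
  "pot \<alpha> m h x = (\<Sum>y\<in>F m. R \<alpha> m x y * h y) / \<alpha>"

abbreviation mass :: "real \<Rightarrow> nat \<Rightarrow> state \<Rightarrow> real" where
  "mass \<alpha> m x \<equiv> \<Sum>y\<in>F m. R \<alpha> m x y"

lemma pot_equation:
  assumes "\<alpha> > 0" "x \<in> F m"
  shows "\<alpha> * pot \<alpha> m h x - (\<Sum>y\<in>F m. Q x y * pot \<alpha> m h y) = h x"
proof -
  let ?P = "\<lambda>x. \<Sum>y\<in>F m. R \<alpha> m x y * h y"
  have "(\<Sum>y\<in>F m. Q x y * pot \<alpha> m h y) = (\<Sum>y\<in>F m. Q x y * ?P y) / \<alpha>"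
    unfolding pot_def sum_divide_distrib[of "\<lambda>y. Q x y * ?P y"]
    by (simp only: times_divide_eq_right)
  then have "\<alpha> * pot \<alpha> m h x - (\<Sum>y\<in>F m. Q x y * pot \<alpha> m h y)
      = (\<alpha> * ?P x - (\<Sum>y\<in>F m. Q x y * ?P y)) / \<alpha>"
    by (simp only: pot_def times_divide_eq_right diff_divide_distrib)
  also have "\<alpha> * ?P x - (\<Sum>y\<in>F m. Q x y * ?P y) = \<alpha> * h x"
    unfolding R_eq by (rule trunc.potential_equation[OF assms])
  finally show ?thesis using assms(1) by simp
qed

lemma mass_equation:
  assumes "\<alpha> > 0" "x \<in> F m"
  shows "\<alpha> * mass \<alpha> m x - (\<Sum>y\<in>F m. Q x y * mass \<alpha> m y) = \<alpha>"
  using trunc.potential_equation[OF assms, of "\<lambda>_. 1"] by (simp add: R_eq)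

end

text \<open>
  The function \<open>W\<close> dominates the expected integral of \<open>c v\<close> along the chain until it hits \<open>y0\<close>. The
  sums run over the levels up to \<open>m\<close> only, since the comparison takes place there.
\<close>
locale hitting_comparison = drift_generator +
  fixes W :: "state \<Rightarrow> real" and y0 :: state and N :: nat
  assumes W_nonneg: "\<And>x. x \<in> state_space S \<Longrightarrow> 0 \<le> W x"
    and W_summable: "(\<lambda>x. p x * W x) summable_on state_space S"
    and y0: "y0 \<in> state_space S"
    and W_super: "\<And>m x. m \<ge> N \<Longrightarrow> x \<in> levels_upto S m \<Longrightarrow> x \<noteq> y0 \<Longrightarrow>
          (\<Sum>y\<in>levels_upto S m. Q x y * W y) \<le> - c * v x"
begin

text \<open>
  The coefficient for which \<open>pot \<alpha> m h - centre \<alpha> m h * mass \<alpha> m\<close> vanishes at \<open>y0\<close>.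
\<close>
definition centre :: "real \<Rightarrow> nat \<Rightarrow> (state \<Rightarrow> real) \<Rightarrow> real" where
  "centre \<alpha> m h = pot \<alpha> m h y0 / mass \<alpha> m y0"

text \<open>
  On the levels up to \<open>m\<close> the difference on the left solves \<open>(\<alpha> - Q_m) d = h - \<alpha> centre\<close> and vanishes
  at \<open>y0\<close>. The right-hand side of this equation is at most \<open>(1 + \<alpha> \<bar>centre\<bar>) c v\<close> in absolute value, as
  \<open>c v \<ge> 1\<close>, so the minimum principle away from \<open>y0\<close> applies to both signs of \<open>d\<close>. Subtracting a
  multiple of \<open>mass\<close> rather than a constant keeps the zero boundary values above level \<open>m\<close>.
\<close>
lemma pot_comparison:
  assumes "\<alpha> > 0" "m \<ge> N" "mass \<alpha> m y0 > 0" and x: "x \<in> F m"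
    and h: "\<And>x. x \<in> E \<Longrightarrow> \<bar>h x\<bar> \<le> c * v x"
  shows "\<bar>pot \<alpha> m h x - centre \<alpha> m h * mass \<alpha> m x\<bar> \<le> (1 + \<alpha> * \<bar>centre \<alpha> m h\<bar>) * W x"
proof -
  define g where "g = centre \<alpha> m h"
  define d where "d = (\<lambda>x. pot \<alpha> m h x - g * mass \<alpha> m x)"
  define a where "a = 1 + \<alpha> * \<bar>g\<bar>"
  have "a \<ge> 1" using \<open>\<alpha> > 0\<close> by (simp add: a_def)
  have d_eq: "\<alpha> * d x - (\<Sum>y\<in>F m. Q x y * d y) = h x - g * \<alpha>" if "x \<in> F m" for x
  proof -
    have "(\<Sum>y\<in>F m. Q x y * d y) = (\<Sum>y\<in>F m. Q x y * pot \<alpha> m h y) - g * (\<Sum>y\<in>F m. Q x y * mass \<alpha> m y)"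
      unfolding d_def right_diff_distrib sum_subtractf
      by (simp add: sum_distrib_left mult.left_commute)
    moreover have "g * (\<alpha> * mass \<alpha> m x - (\<Sum>y\<in>F m. Q x y * mass \<alpha> m y)) = g * \<alpha>"
      by (simp only: mass_equation[OF \<open>\<alpha> > 0\<close> that])
    ultimately show ?thesis
      using pot_equation[OF \<open>\<alpha> > 0\<close> that, of h] by (simp add: d_def algebra_simps)
  qed
  have d0: "d y0 = 0"
    using assms(3) by (simp add: d_def g_def centre_def)
  have "0 \<le> a * W x - \<sigma> * d x" if "\<bar>\<sigma>\<bar> = 1" for \<sigma> :: real
  proof (rule trunc.min_principle[OF \<open>\<alpha> > 0\<close>, of "F m - {y0}"])
    fix x assume "x \<in> F m - {y0}"
    then have x: "x \<in> F m" "x \<noteq> y0" by auto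
    have "(\<Sum>y\<in>F m. Q x y * (a * W y - \<sigma> * d y)) = a * (\<Sum>y\<in>F m. Q x y * W y) - \<sigma> * (\<Sum>y\<in>F m. Q x y * d y)"
      unfolding right_diff_distrib sum_subtractf by (simp add: sum_distrib_left mult.left_commute)
    moreover have "a * (\<Sum>y\<in>F m. Q x y * W y) \<le> a * (- c * v x)"
      using W_super[OF \<open>m \<ge> N\<close> x] \<open>a \<ge> 1\<close> by (intro mult_left_mono) auto
    moreover have "\<sigma> * (\<alpha> * d x - (\<Sum>y\<in>F m. Q x y * d y)) = \<sigma> * (h x - g * \<alpha>)"
      by (simp only: d_eq[OF x(1)])
    moreover have "\<sigma> * (h x - g * \<alpha>) \<le> a * (c * v x)"
    proof -
      have "\<sigma> * (h x - g * \<alpha>) \<le> \<bar>h x - g * \<alpha>\<bar>"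
        using that by (metis abs_ge_self abs_mult mult_1)
      also have "\<dots> \<le> \<bar>h x\<bar> + \<alpha> * \<bar>g\<bar>"
        using \<open>\<alpha> > 0\<close> abs_triangle_ineq4[of "h x" "g * \<alpha>"] by (simp add: abs_mult mult.commute)
      also have "\<dots> \<le> c * v x + \<alpha> * \<bar>g\<bar> * (c * v x)"
        using h[OF F_E[OF x(1)]] \<open>\<alpha> > 0\<close>
          mult_left_mono[OF cv_ge_1[OF F_E[OF x(1)]], of "\<alpha> * \<bar>g\<bar>"]
        by (intro add_mono) auto
      finally show ?thesis by (simp add: a_def algebra_simps)
    qed
    moreover have "0 \<le> \<alpha> * (a * W x)"
      using W_nonneg[OF F_E[OF x(1)]] \<open>\<alpha> > 0\<close> \<open>a \<ge> 1\<close> by simp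
    ultimately show "0 \<le> \<alpha> * (a * W x - \<sigma> * d x) - (\<Sum>y\<in>F m. Q x y * (a * W y - \<sigma> * d y))"
      by (simp add: algebra_simps)
  next
    fix x assume "x \<in> F m" "x \<notin> F m - {y0}"
    then show "0 \<le> a * W x - \<sigma> * d x"
      using d0 W_nonneg[OF y0] \<open>a \<ge> 1\<close> by auto
  qed (fact x)
  from this[of 1] this[of "-1"] show ?thesis
    unfolding d_def a_def g_def by simp
qed

lemma mass_y0_pos:
  assumes "\<alpha> > 0"
  shows "\<forall>\<^sub>F m in sequentially. mass \<alpha> m y0 > 0"
  by (rule order_tendstoD(1)[OF honest[OF assms y0]]) simp

definition mean_W :: real where "mean_W = (\<Sum>\<^sub>\<infinity>x\<in>E. p x * W x)"

lemma mean_W_has_sum: "((\<lambda>x. p x * W x) has_sum mean_W) E"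
  unfolding mean_W_def using W_summable by simp

lemma mean_W_nonneg: "0 \<le> mean_W"
  unfolding mean_W_def by (intro infsum_nonneg mult_nonneg_nonneg p_nonneg W_nonneg)

lemma occ_centered_tendsto:
  assumes "\<alpha> > 0" and h: "\<And>x. x \<in> E \<Longrightarrow> \<bar>h x\<bar> \<le> c * v x" and "((\<lambda>x. p x * h x) has_sum 0) E"
  shows "(\<lambda>m. \<Sum>y\<in>F m. occ \<alpha> m y * h y) \<longlonglongrightarrow> 0"
proof -
  have "(\<lambda>x. p x * (c * v x)) summable_on E"
    using summable_on_cmult_right[OF p_v_summable, of c] by (simp add: mult.left_commute)
  then have "(\<lambda>m. \<Sum>y\<in>F m. (p y - occ \<alpha> m y) * (c * v y)) \<longlonglongrightarrow> 0"
    using c_pos v_pos by (intro occ_weighted_tendsto[OF \<open>\<alpha> > 0\<close>]) (auto intro: less_imp_le has_sum_infsum)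
  then have "(\<lambda>m. \<Sum>y\<in>F m. (p y - occ \<alpha> m y) * h y) \<longlonglongrightarrow> 0"
  proof (rule Lim_null_comparison[rotated])
    show "\<forall>\<^sub>F m in sequentially. norm (\<Sum>y\<in>F m. (p y - occ \<alpha> m y) * h y)
        \<le> (\<Sum>y\<in>F m. (p y - occ \<alpha> m y) * (c * v y))"
      using occ_le[OF \<open>\<alpha> > 0\<close>] h[OF F_E]
      by (intro always_eventually allI order_trans[OF norm_sum] sum_mono)
        (simp add: abs_mult mult_left_mono)
  qed
  from tendsto_diff[OF level_sums_tendsto[OF assms(3)] this] show ?thesis
    by (simp add: left_diff_distrib sum_subtractf)
qed

text \<open>
  Integrate \<open>pot_comparison\<close> against \<open>p\<close>. The term \<open>\<alpha> p (pot h) = occ h\<close> tends to \<open>p h = 0\<close> and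
  \<open>p mass\<close> tends to one, so \<open>\<alpha> \<bar>centre\<bar>\<close> is at most about \<open>\<alpha> B (1 + \<alpha> \<bar>centre\<bar>)\<close>; the smallness of
  \<open>\<alpha> B\<close> permits solving for \<open>centre\<close>. The bound does not depend on \<open>\<alpha>\<close>.
\<close>
lemma centre_bound:
  assumes "\<alpha> > 0" "B > 0" "mean_W \<le> B" "\<alpha> * B \<le> 1 / 4"
    and h: "\<And>x. x \<in> E \<Longrightarrow> \<bar>h x\<bar> \<le> c * v x" and ph: "((\<lambda>x. p x * h x) has_sum 0) E"
  shows "\<forall>\<^sub>F m in sequentially. \<bar>centre \<alpha> m h\<bar> \<le> 4 * B"
proof -
  have "\<forall>\<^sub>F m in sequentially. \<bar>\<Sum>y\<in>F m. occ \<alpha> m y * h y\<bar> < \<alpha> * B"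
    using order_tendstoD(2)[OF tendsto_rabs[OF occ_centered_tendsto[OF \<open>\<alpha> > 0\<close> h ph]], of "\<alpha> * B"] assms
    by simp
  moreover have "\<forall>\<^sub>F m in sequentially. 3 / 4 < (\<Sum>x\<in>F m. p x * mass \<alpha> m x)"
    by (rule order_tendstoD(1)[OF occ_mass_tendsto[OF \<open>\<alpha> > 0\<close>]]) simp
  ultimately show ?thesis
    using mass_y0_pos[OF \<open>\<alpha> > 0\<close>] eventually_ge_at_top[of N]
  proof eventually_elim
    case (elim m)
    define g where "g = centre \<alpha> m h"
    let ?M = "\<Sum>x\<in>F m. p x * mass \<alpha> m x"
    let ?P = "\<Sum>x\<in>F m. p x * pot \<alpha> m h x"
    have P: "\<alpha> * ?P = (\<Sum>y\<in>F m. occ \<alpha> m y * h y)"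
      unfolding occ_sum sum_distrib_left[of \<alpha>]
      using \<open>\<alpha> > 0\<close> by (intro sum.cong refl) (simp add: pot_def)
    have "\<bar>?P - g * ?M\<bar> = \<bar>\<Sum>x\<in>F m. p x * (pot \<alpha> m h x - g * mass \<alpha> m x)\<bar>"
      by (simp add: right_diff_distrib sum_subtractf sum_distrib_left mult.left_commute)
    also have "\<dots> \<le> (\<Sum>x\<in>F m. p x * ((1 + \<alpha> * \<bar>g\<bar>) * W x))"
      unfolding g_def using elim h \<open>\<alpha> > 0\<close> p_nonneg[OF F_E]
      by (intro order_trans[OF sum_abs] sum_mono) (simp add: abs_mult mult_left_mono pot_comparison)
    also have "\<dots> = (1 + \<alpha> * \<bar>g\<bar>) * (\<Sum>x\<in>F m. p x * W x)"
      by (simp add: sum_distrib_left mult.left_commute)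
    also have "\<dots> \<le> (1 + \<alpha> * \<bar>g\<bar>) * B"
      using level_sum_le_has_sum[OF mean_W_has_sum, of m] p_nonneg W_nonneg \<open>mean_W \<le> B\<close> \<open>\<alpha> > 0\<close>
      by (intro mult_left_mono) auto
    finally have "\<alpha> * \<bar>?P - g * ?M\<bar> \<le> \<alpha> * ((1 + \<alpha> * \<bar>g\<bar>) * B)"
      using \<open>\<alpha> > 0\<close> by (intro mult_left_mono) auto
    moreover have "\<alpha> * \<bar>?P - g * ?M\<bar> = \<bar>\<alpha> * (?P - g * ?M)\<bar>"
      using \<open>\<alpha> > 0\<close> by (simp only: abs_mult abs_of_pos)
    ultimately have "\<bar>\<alpha> * ?P - \<alpha> * g * ?M\<bar> \<le> \<alpha> * B + \<alpha> * \<bar>g\<bar> * (\<alpha> * B)"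
      by (simp add: algebra_simps)
    moreover have "\<alpha> * \<bar>g\<bar> * (\<alpha> * B) \<le> \<alpha> * \<bar>g\<bar> * (1 / 4)"
      using assms by (intro mult_left_mono) auto
    moreover have "\<alpha> * \<bar>g\<bar> * (3 / 4) \<le> \<bar>\<alpha> * g * ?M\<bar>"
    proof -
      have "\<alpha> * \<bar>g\<bar> * (3 / 4) \<le> \<alpha> * \<bar>g\<bar> * ?M"
        using elim(2) \<open>\<alpha> > 0\<close> by (intro mult_left_mono) auto
      also have "\<dots> = \<bar>\<alpha> * g * ?M\<bar>"
        using \<open>\<alpha> > 0\<close> elim(2) by (simp add: abs_mult)
      finally show ?thesis .
    qed
    ultimately have "\<alpha> * \<bar>g\<bar> * (1 / 2) \<le> 2 * (\<alpha> * B)"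
      using elim(1) unfolding P by linarith
    then have "\<alpha> * \<bar>g\<bar> \<le> \<alpha> * (4 * B)" by simp
    then show ?case using \<open>\<alpha> > 0\<close> by (simp add: g_def)
  qed
qed

text \<open>
  The identity \<open>flux\<close> is applied to \<open>f = pot \<alpha> m h\<close>. As \<open>m \<longlongrightarrow> \<infinity>\<close> the \<open>mass\<close> parts of the differences
  \<open>f (t i) - f (s i)\<close> cancel, since \<open>mass\<close> tends to one at both ends while its coefficient stays
  bounded; as \<open>\<alpha> \<longlongrightarrow> 0\<close> the term \<open>\<alpha> (\<mu> f)\<close> disappears.
\<close>
lemma flux_bound:
  assumes \<mu>: "\<And>x. x \<in> F n \<Longrightarrow> 0 \<le> \<mu> x" and \<mu>1: "(\<Sum>x\<in>F n. \<mu> x) \<le> 1"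
    and I: "finite I" and J: "\<And>i. i \<in> I \<Longrightarrow> k i \<ge> 0 \<and> s i \<in> E \<and> t i \<in> E"
    and flux: "\<And>\<alpha> f. \<alpha> > 0 \<Longrightarrow> (\<And>x. x \<in> F n \<Longrightarrow> \<alpha> * f x - (\<Sum>y\<in>F (Suc n). Q x y * f y) = h x) \<Longrightarrow>
        (\<Sum>x\<in>F n. \<mu> x * h x) = \<alpha> * (\<Sum>x\<in>F n. \<mu> x * f x) - (\<Sum>i\<in>I. k i * (f (t i) - f (s i)))"
    and h: "\<And>x. x \<in> E \<Longrightarrow> \<bar>h x\<bar> \<le> c * v x" and ph: "((\<lambda>x. p x * h x) has_sum 0) E"
  shows "\<bar>\<Sum>x\<in>F n. \<mu> x * h x\<bar> \<le> (\<Sum>i\<in>I. k i * (W (s i) + W (t i)))"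
proof -
  define B where "B = mean_W + 1"
  have B: "B > 0" "mean_W \<le> B" using mean_W_nonneg by (auto simp: B_def)
  define D where "D = (\<Sum>x\<in>F n. \<mu> x * W x)"
  define Z where "Z = (\<Sum>i\<in>I. k i * (W (s i) + W (t i)))"
  have fixed: "\<bar>\<Sum>x\<in>F n. \<mu> x * h x\<bar> \<le> \<alpha> * (4 * B + (1 + 4 * \<alpha> * B) * D) + (1 + 4 * \<alpha> * B) * Z"
    if \<alpha>: "\<alpha> > 0" "\<alpha> * B \<le> 1 / 4" for \<alpha>
  proof (rule tendsto_lowerbound)
    let ?rhs = "\<lambda>m. \<alpha> * (4 * B + (1 + 4 * \<alpha> * B) * D)
        + (\<Sum>i\<in>I. k i * (4 * B * \<bar>mass \<alpha> m (t i) - mass \<alpha> m (s i)\<bar> + (1 + 4 * \<alpha> * B) * (W (s i) + W (t i))))"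
    have "?rhs \<longlonglongrightarrow> \<alpha> * (4 * B + (1 + 4 * \<alpha> * B) * D)
        + (\<Sum>i\<in>I. k i * (4 * B * \<bar>1 - 1\<bar> + (1 + 4 * \<alpha> * B) * (W (s i) + W (t i))))"
      using J \<alpha>(1) by (intro tendsto_intros honest) auto
    then show "?rhs \<longlonglongrightarrow> \<alpha> * (4 * B + (1 + 4 * \<alpha> * B) * D) + (1 + 4 * \<alpha> * B) * Z"
      by (simp add: Z_def sum_distrib_left mult.left_commute)
    have ev: "\<forall>\<^sub>F m in sequentially. \<forall>i\<in>I. s i \<in> F m \<and> t i \<in> F m"
      using J by (intro eventually_ball_finite[OF I] ballI eventually_conj eventually_in_F) auto
    have "\<forall>\<^sub>F m in sequentially. \<bar>centre \<alpha> m h\<bar> \<le> 4 * B"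
      by (rule centre_bound[OF \<alpha>(1) B \<alpha>(2) _ ph]) (rule h)
    then show "\<forall>\<^sub>F m in sequentially. \<bar>\<Sum>x\<in>F n. \<mu> x * h x\<bar> \<le> ?rhs m"
      using mass_y0_pos[OF \<alpha>(1)]
        eventually_ge_at_top[of "max N (Suc n)"] ev
    proof eventually_elim
      case (elim m)
      let ?f = "pot \<alpha> m h"
      define g where "g = centre \<alpha> m h"
      have g: "\<bar>g\<bar> \<le> 4 * B" using elim(1) by (simp add: g_def)
      have "m \<ge> N" "Suc n \<le> m" using elim(3) by auto
      have cmp: "\<bar>?f x - g * mass \<alpha> m x\<bar> \<le> (1 + 4 * \<alpha> * B) * W x" if "x \<in> F m" for x
      proof -
        have "\<bar>?f x - g * mass \<alpha> m x\<bar> \<le> (1 + \<alpha> * \<bar>g\<bar>) * W x"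
          unfolding g_def by (rule pot_comparison[OF \<alpha>(1) \<open>m \<ge> N\<close> elim(2) that h])
        also have "\<dots> \<le> (1 + \<alpha> * (4 * B)) * W x"
          using W_nonneg[OF F_E[OF that]] g \<alpha> by (intro mult_right_mono add_left_mono mult_left_mono) auto
        finally show ?thesis by (simp add: mult_ac)
      qed
      have eq: "(\<Sum>x\<in>F n. \<mu> x * h x) = \<alpha> * (\<Sum>x\<in>F n. \<mu> x * ?f x) - (\<Sum>i\<in>I. k i * (?f (t i) - ?f (s i)))"
      proof (rule flux[OF \<alpha>(1)])
        fix x assume x: "x \<in> F n"
        then have "x \<in> F m" using \<open>Suc n \<le> m\<close> by (auto intro: F_mono[of n m])
        have "(\<Sum>y\<in>F m. Q x y * ?f y) = (\<Sum>y\<in>F (Suc n). Q x y * ?f y)"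
          using Q_zero_beyond[OF x] F_E \<open>Suc n \<le> m\<close>
          by (intro sum.mono_neutral_right finite_levels_upto mono_levels_upto) auto
        then show "\<alpha> * ?f x - (\<Sum>y\<in>F (Suc n). Q x y * ?f y) = h x"
          using pot_equation[OF \<alpha>(1) \<open>x \<in> F m\<close>, of h] by simp
      qed
      have "\<bar>\<Sum>x\<in>F n. \<mu> x * ?f x\<bar> \<le> (\<Sum>x\<in>F n. \<mu> x * (4 * B + (1 + 4 * \<alpha> * B) * W x))"
      proof (intro order_trans[OF sum_abs] sum_mono)
        fix x assume x: "x \<in> F n"
        then have xm: "x \<in> F m" using \<open>Suc n \<le> m\<close> by (auto intro: F_mono[of n m])
        have m1: "0 \<le> mass \<alpha> m x" "mass \<alpha> m x \<le> 1"
          using trunc.res_row_sum_le_1[OF \<alpha>(1) xm] \<alpha>(1) xm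
          by (auto simp: R_eq intro!: sum_nonneg trunc.res_nonneg)
        have "\<bar>g * mass \<alpha> m x\<bar> \<le> 4 * B * 1"
          unfolding abs_mult using g m1 by (intro mult_mono) auto
        then have "\<bar>?f x\<bar> \<le> 4 * B + (1 + 4 * \<alpha> * B) * W x"
          using cmp[OF xm] by linarith
        then show "\<bar>\<mu> x * ?f x\<bar> \<le> \<mu> x * (4 * B + (1 + 4 * \<alpha> * B) * W x)"
          using \<mu>[OF x] by (simp add: abs_mult mult_left_mono)
      qed
      also have "\<dots> = 4 * B * (\<Sum>x\<in>F n. \<mu> x) + (1 + 4 * \<alpha> * B) * D"
        by (simp add: D_def algebra_simps sum.distrib sum_distrib_left)
      also have "4 * B * (\<Sum>x\<in>F n. \<mu> x) \<le> 4 * B * 1"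
        using \<mu>1 B by (intro mult_left_mono) auto
      finally have first: "\<alpha> * \<bar>\<Sum>x\<in>F n. \<mu> x * ?f x\<bar> \<le> \<alpha> * (4 * B + (1 + 4 * \<alpha> * B) * D)"
        using \<alpha>(1) by simp
      have second: "\<bar>\<Sum>i\<in>I. k i * (?f (t i) - ?f (s i))\<bar>
        \<le> (\<Sum>i\<in>I. k i * (4 * B * \<bar>mass \<alpha> m (t i) - mass \<alpha> m (s i)\<bar> + (1 + 4 * \<alpha> * B) * (W (s i) + W (t i))))"
      proof (intro order_trans[OF sum_abs] sum_mono)
        fix i assume i: "i \<in> I"
        have "?f (t i) - ?f (s i) = g * (mass \<alpha> m (t i) - mass \<alpha> m (s i))
            + ((?f (t i) - g * mass \<alpha> m (t i)) - (?f (s i) - g * mass \<alpha> m (s i)))"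
          by (simp add: algebra_simps)
        moreover have "\<bar>g * (mass \<alpha> m (t i) - mass \<alpha> m (s i))\<bar> \<le> 4 * B * \<bar>mass \<alpha> m (t i) - mass \<alpha> m (s i)\<bar>"
          unfolding abs_mult using g by (intro mult_right_mono) auto
        ultimately have "\<bar>?f (t i) - ?f (s i)\<bar> \<le> 4 * B * \<bar>mass \<alpha> m (t i) - mass \<alpha> m (s i)\<bar> + (1 + 4 * \<alpha> * B) * (W (s i) + W (t i))"
          using cmp[of "t i"] cmp[of "s i"] elim(4) i by (simp add: distrib_left)
        then show "\<bar>k i * (?f (t i) - ?f (s i))\<bar>
          \<le> k i * (4 * B * \<bar>mass \<alpha> m (t i) - mass \<alpha> m (s i)\<bar> + (1 + 4 * \<alpha> * B) * (W (s i) + W (t i)))"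
          using J[OF i] by (simp add: abs_mult mult_left_mono)
      qed
      have "\<bar>\<Sum>x\<in>F n. \<mu> x * h x\<bar> \<le> \<alpha> * \<bar>\<Sum>x\<in>F n. \<mu> x * ?f x\<bar> + \<bar>\<Sum>i\<in>I. k i * (?f (t i) - ?f (s i))\<bar>"
        unfolding eq using \<alpha>(1) abs_triangle_ineq4[of "\<alpha> * (\<Sum>x\<in>F n. \<mu> x * ?f x)"] by (simp add: abs_mult)
      then show ?case using first second by linarith
    qed
  qed simp
  have "\<bar>\<Sum>x\<in>F n. \<mu> x * h x\<bar> \<le> 0 * (4 * B + (1 + 4 * 0 * B) * D) + (1 + 4 * 0 * B) * Z"
  proof (rule tendsto_lowerbound)
    show "((\<lambda>\<alpha>. \<alpha> * (4 * B + (1 + 4 * \<alpha> * B) * D) + (1 + 4 * \<alpha> * B) * Z)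
       \<longlongrightarrow> 0 * (4 * B + (1 + 4 * 0 * B) * D) + (1 + 4 * 0 * B) * Z) (at_right 0)"
      by (intro tendsto_intros)
    have "\<forall>\<^sub>F \<alpha> in at_right 0. \<alpha> \<in> {0<..<1 / (4 * B)}"
      by (rule eventually_at_rightI[of 0 "1 / (4 * B)"]) (use B in auto)
    then show "\<forall>\<^sub>F \<alpha> in at_right 0. \<bar>\<Sum>x\<in>F n. \<mu> x * h x\<bar>
        \<le> \<alpha> * (4 * B + (1 + 4 * \<alpha> * B) * D) + (1 + 4 * \<alpha> * B) * Z"
      by eventually_elim (rule fixed, use B in \<open>auto simp: field_simps\<close>)
  qed simp
  then show ?thesis by (simp add: Z_def)
qed

end

section \<open>The truncated chain and its flux across the top level\<close>

context skip_free_generator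
begin

text \<open>
  In a column block above level \<open>n\<close> the truncated matrix has only its diagonal block. The states of
  such a level that carry mass would therefore form a closed set for \<open>Q\<close>, against irreducibility.
\<close>
lemma lc_trunc_no_mass_above:
  assumes irred: "irreducible_qmatrix E Q"
    and stat: "stationary_distribution E (lc_trunc n Q) \<mu>"
    and x: "x \<in> E" "n < fst x"
  shows "\<mu> x = 0"
proof (rule ccontr)
  assume "\<mu> x \<noteq> 0"
  define l where "l = fst x"
  define L where "L = Pair l ` {..S l}"
  have "finite L" by (simp add: L_def)
  have LE: "L \<subseteq> E" by (auto simp: L_def state_space_def)
  have "x \<in> L" using x by (auto simp: L_def l_def state_space_def image_iff)
  have \<mu>0: "0 \<le> \<mu> y" if "y \<in> E" for y using stat that by (simp add: stationary_distribution_def)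
  have col: "(\<Sum>z\<in>L. \<mu> z * Q z y) = 0" if "y \<in> L" for y
  proof -
    have "((\<lambda>z. \<mu> z * lc_trunc n Q z y) has_sum 0) E"
      using stat LE that by (auto simp: stationary_distribution_def)
    moreover have "((\<lambda>z. \<mu> z * lc_trunc n Q z y) has_sum 0) E \<longleftrightarrow> ((\<lambda>z. \<mu> z * Q z y) has_sum 0) L"
    proof (rule has_sum_cong_neutral)
      show "\<mu> z * lc_trunc n Q z y = 0" if "z \<in> E - L" for z
      proof -
        have "fst z \<noteq> l" using that by (cases z) (auto simp: L_def state_space_def)
        then show ?thesis using \<open>y \<in> L\<close> x(2) by (cases z) (auto simp: L_def l_def)
      qed
      show "\<mu> z * lc_trunc n Q z y = \<mu> z * Q z y" if "z \<in> E \<inter> L" for z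
        using that \<open>y \<in> L\<close> x(2) by (auto simp: L_def l_def)
    qed (use LE in auto)
    ultimately show ?thesis using \<open>finite L\<close> has_sum_unique[OF has_sum_finite] by blast
  qed
  have row: "(\<Sum>y\<in>A. Q z y) \<le> 0" if "z \<in> A" "finite A" "A \<subseteq> E" for z A
  proof (rule finite_sum_le_has_sum[OF _ that(2,3)])
    show "(Q z has_sum 0) E" using conservative that by (auto simp: conservative_def)
    show "0 \<le> Q z y" if "y \<in> E - A" for y
      using that \<open>z \<in> A\<close> \<open>A \<subseteq> E\<close> by (intro off_diagonal) auto
  qed
  have "(\<Sum>z\<in>L. - (\<mu> z * (\<Sum>y\<in>L. Q z y))) = - (\<Sum>y\<in>L. \<Sum>z\<in>L. \<mu> z * Q z y)"
    by (subst sum.swap) (simp add: sum_negf sum_distrib_left)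
  also have "\<dots> = 0" by (simp add: col)
  finally have "\<forall>z\<in>L. - (\<mu> z * (\<Sum>y\<in>L. Q z y)) = 0"
    using \<open>finite L\<close> LE row[OF _ \<open>finite L\<close> LE] \<mu>0
    by (subst (asm) sum_nonneg_eq_0_iff) (auto simp: mult_nonneg_nonpos subset_iff)
  then have row0: "(\<Sum>y\<in>L. Q z y) = 0" if "z \<in> L" "\<mu> z > 0" for z using that by auto
  define G where "G = {z \<in> L. \<mu> z > 0}"
  have closed: "y \<in> G" if "z \<in> G" "y \<in> E" "z \<noteq> y" "Q z y > 0" for z y
  proof -
    have z: "z \<in> L" "\<mu> z > 0" using that by (auto simp: G_def)
    have "y \<in> L"
    proof (rule ccontr)
      assume "y \<notin> L"
      have "(\<Sum>w\<in>insert y L. Q z w) \<le> 0"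
        using z that LE \<open>finite L\<close> by (intro row) auto
      then show False using row0[OF z] \<open>y \<notin> L\<close> \<open>finite L\<close> \<open>Q z y > 0\<close> by simp
    qed
    moreover have "\<mu> y \<noteq> 0"
    proof
      assume "\<mu> y = 0"
      have nn: "0 \<le> \<mu> w * Q w y" if "w \<in> L" for w
      proof (cases "w = y")
        case False
        then show ?thesis
          using that LE \<open>y \<in> L\<close> by (intro mult_nonneg_nonneg \<mu>0 off_diagonal) auto
      qed (use \<open>\<mu> y = 0\<close> in simp)
      have "\<mu> z * Q z y \<le> (\<Sum>w\<in>L. \<mu> w * Q w y)"
        using z(1) nn \<open>finite L\<close> by (intro member_le_sum[where f = "\<lambda>w. \<mu> w * Q w y"]) auto
      then show False using col[OF \<open>y \<in> L\<close>] z(2) \<open>Q z y > 0\<close> mult_pos_pos[of "\<mu> z" "Q z y"] by linarith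
    qed
    ultimately show ?thesis using \<mu>0[of y] \<open>y \<in> E\<close> by (simp add: G_def)
  qed
  have "(x, (0, 0)) \<in> {(u, w). u \<in> E \<and> w \<in> E \<and> u \<noteq> w \<and> Q u w > 0}\<^sup>*"
    using irred x by (auto simp: irreducible_qmatrix_def leads_to_def state_space_def)
  then have "(0, 0) \<in> G"
  proof (induction rule: rtrancl_induct)
    case base
    then show ?case using \<open>x \<in> L\<close> \<mu>0[OF x(1)] \<open>\<mu> x \<noteq> 0\<close> by (simp add: G_def)
  next
    case (step y z)
    then show ?case using closed by blast
  qed
  then show False using x(2) by (auto simp: G_def L_def l_def)
qed

lemma lc_trunc_entry:
  assumes width: "\<And>m. m \<ge> n \<Longrightarrow> S m = S n" and x: "x \<in> F n" and y: "y \<in> F n"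
  shows "lc_trunc n Q x y = Q x y + (if fst y = n then Q x (Suc n, snd y) else 0)"
proof -
  obtain k i l j where xy: "x = (k, i)" "y = (l, j)" by (cases x, cases y)
  have "(\<Sum>\<^sub>\<infinity>m\<in>{m. m > n \<and> m \<noteq> k}. Q (k, i) (m, j)) = (\<Sum>\<^sub>\<infinity>m\<in>{Suc n}. Q (k, i) (m, j))" if "l = n"
  proof (rule infsum_cong_neutral)
    fix m assume m: "m \<in> {m. m > n \<and> m \<noteq> k} - {Suc n}"
    then have "S m = S n" by (intro width) auto
    then show "Q (k, i) (m, j) = 0"
      using m x y xy that by (intro skip_free) (auto simp: levels_upto_def state_space_def)
  qed (use x xy in \<open>auto simp: levels_upto_def\<close>)
  then show ?thesis using y xy by (auto simp: levels_upto_def)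
qed

lemma levels_upto_Suc_sum:
  "(\<Sum>y\<in>F (Suc n). u y) = (\<Sum>y\<in>F n. u y) + (\<Sum>j\<le>S (Suc n). u (Suc n, j) :: real)"
proof -
  have "F (Suc n) = F n \<union> Pair (Suc n) ` {..S (Suc n)}"
    by (auto simp: levels_upto_def image_iff le_Suc_eq)
  then have "(\<Sum>y\<in>F (Suc n). u y) = (\<Sum>y\<in>F n. u y) + (\<Sum>y\<in>Pair (Suc n) ` {..S (Suc n)}. u y)"
    by (simp only:) (rule sum.union_disjoint[OF finite_levels_upto]; auto simp: levels_upto_def)
  then show ?thesis by (simp add: sum.reindex inj_on_def)
qed

lemma top_level_sum:
  assumes "\<And>x. x \<in> F n \<Longrightarrow> fst x \<noteq> n \<Longrightarrow> u x = (0::real)"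
  shows "(\<Sum>x\<in>F n. u x) = (\<Sum>i\<le>S n. u (n, i))"
proof -
  have "(\<Sum>x\<in>F n. u x) = (\<Sum>x\<in>Pair n ` {..S n}. u x)"
  proof (intro sum.mono_neutral_right finite_levels_upto ballI)
    fix x assume x: "x \<in> F n - Pair n ` {..S n}"
    then have "fst x \<noteq> n" by (cases x) (auto simp: levels_upto_def)
    then show "u x = 0" using assms x by blast
  qed (auto simp: levels_upto_def)
  then show ?thesis by (simp add: sum.reindex inj_on_def)
qed

text \<open>
  Within the levels up to \<open>n\<close>, the truncated matrix applied to \<open>f\<close> differs from \<open>Q f\<close> only in that
  jumps from \<open>(n, i)\<close> to \<open>(n + 1, j)\<close> read \<open>f\<close> at \<open>(n, j)\<close>. The sum of the columns of the stationarity
  equation, weighted with \<open>f\<close>, is finite and may be rearranged by rows.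
\<close>
lemma lc_trunc_flux:
  assumes irred: "irreducible_qmatrix E Q"
    and stat: "stationary_distribution E (lc_trunc n Q) \<mu>"
    and width: "\<And>m. m \<ge> n \<Longrightarrow> S m = S n"
    and eq: "\<And>x. x \<in> F n \<Longrightarrow> \<alpha> * f x - (\<Sum>y\<in>F (Suc n). Q x y * f y) = h x"
  shows "(\<Sum>x\<in>F n. \<mu> x * h x) = \<alpha> * (\<Sum>x\<in>F n. \<mu> x * f x)
      - (\<Sum>(i, j)\<in>{..S n} \<times> {..S (Suc n)}. \<mu> (n, i) * Q (n, i) (Suc n, j) * (f (Suc n, j) - f (n, j)))"
proof -
  have S: "S (Suc n) = S n" by (rule width) simp
  let ?up = "\<lambda>x. \<Sum>j\<le>S n. Q x (Suc n, j) * (f (n, j) - f (Suc n, j))"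
  have col: "(\<Sum>x\<in>F n. \<mu> x * lc_trunc n Q x y) = 0" if "y \<in> F n" for y
  proof -
    have "((\<lambda>x. \<mu> x * lc_trunc n Q x y) has_sum 0) E"
      using stat F_E[OF that] by (simp add: stationary_distribution_def)
    moreover have "((\<lambda>x. \<mu> x * lc_trunc n Q x y) has_sum 0) E \<longleftrightarrow> ((\<lambda>x. \<mu> x * lc_trunc n Q x y) has_sum 0) (F n)"
    proof (rule has_sum_cong_neutral)
      show "\<mu> x * lc_trunc n Q x y = 0" if "x \<in> E - F n" for x
        using that lc_trunc_no_mass_above[OF irred stat, of x]
        by (cases x) (auto simp: levels_upto_def state_space_def)
    qed (use F_E in auto)
    ultimately show ?thesis using has_sum_unique[OF has_sum_finite[OF finite_levels_upto]] by blast
  qed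
  have row: "(\<Sum>y\<in>F n. lc_trunc n Q x y * f y) = \<alpha> * f x - h x + ?up x" if x: "x \<in> F n" for x
  proof -
    have "(\<Sum>y\<in>F n. lc_trunc n Q x y * f y)
        = (\<Sum>y\<in>F n. Q x y * f y) + (\<Sum>y\<in>F n. if fst y = n then Q x (Suc n, snd y) * f y else 0)"
      unfolding sum.distrib[symmetric]
      by (intro sum.cong refl) (simp add: lc_trunc_entry[OF width x] algebra_simps)
    also have "(\<Sum>y\<in>F n. if fst y = n then Q x (Suc n, snd y) * f y else 0) = (\<Sum>j\<le>S n. Q x (Suc n, j) * f (n, j))"
      by (subst top_level_sum) auto
    also have "(\<Sum>y\<in>F n. Q x y * f y) = (\<Sum>y\<in>F (Suc n). Q x y * f y) - (\<Sum>j\<le>S n. Q x (Suc n, j) * f (Suc n, j))"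
      by (simp add: levels_upto_Suc_sum S)
    finally show ?thesis using eq[OF x] by (simp add: right_diff_distrib sum_subtractf)
  qed
  have "0 = (\<Sum>y\<in>F n. (\<Sum>x\<in>F n. \<mu> x * lc_trunc n Q x y) * f y)"
    by (simp add: col)
  also have "\<dots> = (\<Sum>x\<in>F n. \<mu> x * (\<Sum>y\<in>F n. lc_trunc n Q x y * f y))"
    unfolding sum_distrib_left sum_distrib_right by (subst sum.swap) (simp add: mult.assoc)
  also have "\<dots> = (\<Sum>x\<in>F n. \<alpha> * (\<mu> x * f x) - \<mu> x * h x + \<mu> x * ?up x)"
    by (intro sum.cong refl) (simp only: row, simp only: distrib_left right_diff_distrib mult.left_commute)
  also have "\<dots> = \<alpha> * (\<Sum>x\<in>F n. \<mu> x * f x) - (\<Sum>x\<in>F n. \<mu> x * h x) + (\<Sum>x\<in>F n. \<mu> x * ?up x)"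
    by (simp add: sum.distrib sum_subtractf sum_distrib_left)
  also have "(\<Sum>x\<in>F n. \<mu> x * ?up x) = (\<Sum>i\<le>S n. \<mu> (n, i) * ?up (n, i))"
  proof (rule top_level_sum)
    fix x assume x: "x \<in> F n" "fst x \<noteq> n"
    have "Q x (Suc n, j) = 0" if "j \<le> S n" for j
      using x that S by (intro skip_free F_E[OF x(1)]) (auto simp: levels_upto_def state_space_def)
    then show "\<mu> x * ?up x = 0" by simp
  qed
  also have "\<dots> = - (\<Sum>(i, j)\<in>{..S n} \<times> {..S (Suc n)}. \<mu> (n, i) * Q (n, i) (Suc n, j) * (f (Suc n, j) - f (n, j)))"
    unfolding S sum.cartesian_product[symmetric] sum_negf[symmetric] sum_distrib_left
    by (intro sum.cong refl) (simp add: algebra_simps)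
  finally show ?thesis by simp
qed

end

section \<open>The error bound\<close>

lemma has_sum_diff:
  fixes f g :: "'a \<Rightarrow> real"
  assumes "(f has_sum s) A" "(g has_sum t) A"
  shows "((\<lambda>x. f x - g x) has_sum (s - t)) A"
  using has_sum_add[OF assms(1) has_sum_uminusI[OF assms(2)]] by simp

lemma weighted_eq_ennreal_infsum:
  assumes "(\<lambda>x. p x * g x) summable_on A" "\<And>x. x \<in> A \<Longrightarrow> 0 \<le> p x * g x"
  shows "weighted A p g = ennreal (\<Sum>\<^sub>\<infinity>x\<in>A. p x * g x)"
proof -
  have "weighted A p g = (SUP B\<in>{B. finite B \<and> B \<subseteq> A}. \<Sum>x\<in>B. ennreal (p x * g x))"
    unfolding weighted_def by (rule nonneg_infsum_complete) simp
  also have "\<dots> = (SUP B\<in>{B. finite B \<and> B \<subseteq> A}. ennreal (\<Sum>x\<in>B. p x * g x))"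
    using assms(2) by (intro SUP_cong refl sum_ennreal) auto
  also have "\<dots> = ennreal (\<Sum>\<^sub>\<infinity>x\<in>A. p x * g x)"
    by (rule infsum_nonneg_is_SUPREMUM_ennreal[symmetric]) (use assms in auto)
  finally show ?thesis .
qed

context skip_free_generator
begin

text \<open>
  Choose a horizon \<open>T\<close> long compared to \<open>1 / \<alpha>\<close>, and then so many levels that the chain stays in them
  up to time \<open>T\<close> with probability close to one.
\<close>
lemma honest_resolvent:
  assumes chain: "regular_jump_chain E M X" and gen: "is_generator E M X Q"
    and "\<alpha> > 0" "x \<in> E"
  shows "(\<lambda>m. \<Sum>y\<in>F m. R \<alpha> m x y) \<longlonglongrightarrow> 1"
proof (rule order_tendstoI)
  have mc: "markov_chain E M X" using chain by (simp add: regular_jump_chain_def)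
  show "\<forall>\<^sub>F m in sequentially. (\<Sum>y\<in>F m. R \<alpha> m x y) < a" if "1 < a" for a
    using eventually_in_F[OF \<open>x \<in> E\<close>]
  proof eventually_elim
    case (elim m)
    then show ?case
      using trunc.res_row_sum_le_1[OF \<open>\<alpha> > 0\<close> elim] that by (simp add: R_eq)
  qed
  show "\<forall>\<^sub>F m in sequentially. a < (\<Sum>y\<in>F m. R \<alpha> m x y)" if "a < 1" for a
  proof -
    obtain T :: nat where T: "1 / (\<alpha> * (1 - a)) < real T" using reals_Archimedean2 by blast
    moreover have "0 < 1 / (\<alpha> * (1 - a))" using \<open>a < 1\<close> \<open>\<alpha> > 0\<close> by simp
    ultimately have "T > 0" by (metis of_nat_0_less_iff less_trans)
    have pos: "0 < 1 + \<alpha> * T" using \<open>\<alpha> > 0\<close> by (simp add: add_pos_nonneg)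
    have "1 < \<alpha> * real T * (1 - a)"
      using T \<open>a < 1\<close> \<open>\<alpha> > 0\<close> by (simp add: field_simps)
    then have q: "a < 1 * (1 - 1 / (1 + \<alpha> * T))"
      using pos \<open>a < 1\<close> by (simp add: field_simps)
    let ?p = "\<lambda>m. measure (M x) {w \<in> space (M x). \<forall>t\<in>{0..real T} \<inter> \<rat>. X t w \<in> F m}"
    have "(\<lambda>m. ?p m * (1 - 1 / (1 + \<alpha> * T))) \<longlonglongrightarrow> 1 * (1 - 1 / (1 + \<alpha> * T))"
      by (intro tendsto_intros stay_prob_tendsto_1[OF chain \<open>x \<in> E\<close>]) auto
    then have "\<forall>\<^sub>F m in sequentially. a < ?p m * (1 - 1 / (1 + \<alpha> * T))"
      by (rule order_tendstoD(1)) (rule q)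
    then show ?thesis
      using eventually_in_F[OF \<open>x \<in> E\<close>]
    proof eventually_elim
      case (elim m)
      have "?p m * (1 - 1 / (1 + \<alpha> * T)) \<le> (\<Sum>y\<in>F m. trunc.res m \<alpha> x y)"
        by (rule trunc.res_row_sum_ge_stay_prob[OF mc gen levels_upto_subset \<open>\<alpha> > 0\<close> elim(2) \<open>T > 0\<close>])
      then show ?case using elim(1) by (simp add: R_eq)
    qed
  qed
qed

end

context drift_generator
begin

text \<open>
  Take \<open>W = v + b/(\<beta> \<epsilon>) (1 - \<psi>)\<close>, where \<open>\<psi> \<le> 1\<close> is the column of the truncated resolvent at the
  state \<open>y0\<close> that attains \<open>\<epsilon> = phi_bar\<close>. On the levels up to \<open>K\<close> the growth \<open>Q \<psi> = \<beta> \<psi> \<ge> \<beta> \<epsilon>\<close>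
  compensates the term \<open>b\<close> of the drift condition.
\<close>
lemma hitting_comparison_exists:
  assumes "\<beta> > 0" "N \<ge> K"
    and corner: "\<And>x y. x \<in> F K \<Longrightarrow> y \<in> F K \<Longrightarrow> 0 < R \<beta> N x y"
  obtains W y0 where "hitting_comparison S Q p v b c K W y0 N"
    and "\<And>x. x \<in> E \<Longrightarrow> W x \<le> v x + b / (\<beta> * phi_bar S Q \<beta> K N)"
    and "phi_bar S Q \<beta> K N > 0"
proof -
  let ?q = "\<lambda>y. MIN x\<in>F K. R \<beta> N x y"
  define \<epsilon> where "\<epsilon> = phi_bar S Q \<beta> K N"
  have KN: "F K \<subseteq> F N" using \<open>N \<ge> K\<close> by (rule mono_levels_upto)
  have z: "(0, 0) \<in> F K" by (simp add: levels_upto_def)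
  then have ne: "F K \<noteq> {}" "F N \<noteq> {}" using KN by auto
  have \<epsilon>: "\<epsilon> = Max (?q ` F N)"
    unfolding \<epsilon>_def phi_bar_def using ne finite_levels_upto by (intro cSup_eq_Max) auto
  have "\<epsilon> \<in> ?q ` F N"
    unfolding \<epsilon> using ne finite_levels_upto by (intro Max_in) auto
  then obtain y0 where y0: "y0 \<in> F N" "\<epsilon> = ?q y0" by blast
  have "0 < ?q (0, 0)"
    using ne finite_levels_upto corner z by (subst Min_gr_iff) auto
  also have "?q (0, 0) \<le> \<epsilon>"
    unfolding \<epsilon> using z KN finite_levels_upto by (intro Max_ge) auto
  finally have "\<epsilon> > 0" .
  have \<epsilon>_le: "\<epsilon> \<le> R \<beta> N x y0" if "x \<in> F K" for x
    unfolding y0(2) using that finite_levels_upto by (intro Min_le) auto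
  define \<psi> where "\<psi> = (\<lambda>x. if x \<in> F N then R \<beta> N x y0 else 0)"
  have \<psi>01: "0 \<le> \<psi> x" "\<psi> x \<le> 1" for x
    using y0(1) \<open>\<beta> > 0\<close> by (auto simp: \<psi>_def R_eq trunc.res_nonneg trunc.res_le_1)
  define \<kappa> where "\<kappa> = b / (\<beta> * \<epsilon>)"
  have \<kappa>: "\<kappa> \<ge> 0" "\<kappa> * (\<beta> * \<epsilon>) = b"
    using b_pos \<open>\<beta> > 0\<close> \<open>\<epsilon> > 0\<close> by (auto simp: \<kappa>_def)
  define W where "W = (\<lambda>x. v x + \<kappa> * (1 - \<psi> x))"
  have W_le: "W x \<le> v x + \<kappa>" for x
    using mult_left_mono[OF \<psi>01(1)[of x] \<kappa>(1)] by (simp add: W_def right_diff_distrib)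
  have W_nonneg: "0 \<le> W x" if "x \<in> E" for x
    using v_pos[OF that] \<psi>01[of x] \<kappa>(1) by (simp add: W_def)
  have \<psi>_drift: "\<beta> * \<epsilon> * indicator (F K) x \<le> (\<Sum>y\<in>F (Suc m). Q x y * \<psi> y)"
    if "m \<ge> N" "x \<in> F m" "x \<noteq> y0" for m x
  proof -
    have "F N \<subseteq> F (Suc m)" using \<open>m \<ge> N\<close> by (intro mono_levels_upto) simp
    then have eq: "(\<Sum>y\<in>F (Suc m). Q x y * \<psi> y) = (\<Sum>y\<in>F N. Q x y * R \<beta> N y y0)"
      by (intro sum.mono_neutral_cong_right finite_levels_upto) (auto simp: \<psi>_def)
    show ?thesis
    proof (cases "x \<in> F N")
      case True
      have "(\<Sum>y\<in>F N. Q x y * R \<beta> N y y0) = \<beta> * R \<beta> N x y0"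
        using trunc.res_equation[OF \<open>\<beta> > 0\<close> True y0(1)] \<open>x \<noteq> y0\<close> by (simp add: R_eq)
      moreover have "\<beta> * \<epsilon> * indicator (F K) x \<le> \<beta> * R \<beta> N x y0"
        using \<epsilon>_le[of x] \<open>\<beta> > 0\<close> R_nonneg[OF \<open>\<beta> > 0\<close> True y0(1)] by (cases "x \<in> F K") auto
      ultimately show ?thesis using eq by simp
    next
      case False
      then have "x \<notin> F K" using KN by auto
      moreover have "0 \<le> (\<Sum>y\<in>F N. Q x y * R \<beta> N y y0)"
      proof (rule sum_nonneg)
        fix y assume y: "y \<in> F N"
        then have "x \<noteq> y" using False by auto
        then show "0 \<le> Q x y * R \<beta> N y y0"
          using y y0(1) \<open>\<beta> > 0\<close> \<open>x \<in> F m\<close> by (intro mult_nonneg_nonneg off_diagonal R_nonneg F_E)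
      qed
      ultimately show ?thesis using eq by simp
    qed
  qed
  have "hitting_comparison S Q p v b c K W y0 N"
  proof
    show "(\<lambda>x. p x * W x) summable_on E"
    proof (rule summable_on_comparison_test)
      show "(\<lambda>x. p x * v x + p x * \<kappa>) summable_on E"
        by (intro summable_on_add p_v_summable summable_on_cmult_left has_sum_imp_summable[OF p_sum])
      show "p x * W x \<le> p x * v x + p x * \<kappa>" if "x \<in> E" for x
        using mult_left_mono[OF W_le p_nonneg[OF that]] by (simp add: distrib_left)
    qed (intro mult_nonneg_nonneg p_nonneg W_nonneg)
    fix m x assume m: "m \<ge> N" and x: "x \<in> F m" and "x \<noteq> y0"
    have "(\<Sum>y\<in>F m. Q x y * W y) \<le> (\<Sum>y\<in>F (Suc m). Q x y * W y)"
      by (rule row_sum_mono[OF x W_nonneg])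
    also have "\<dots> = (\<Sum>y\<in>F (Suc m). Q x y * v y) + \<kappa> * (\<Sum>y\<in>F (Suc m). Q x y) - \<kappa> * (\<Sum>y\<in>F (Suc m). Q x y * \<psi> y)"
      unfolding W_def by (simp add: algebra_simps sum.distrib sum_subtractf sum_distrib_left)
    also have "\<dots> \<le> (- c * v x + b * indicator (F K) x) + \<kappa> * 0 - \<kappa> * (\<beta> * \<epsilon> * indicator (F K) x)"
      unfolding row_sum_zero[OF x]
      using drift_next[OF x] mult_left_mono[OF \<psi>_drift[OF m x \<open>x \<noteq> y0\<close>] \<kappa>(1)]
      by linarith
    also have "\<dots> = - c * v x" using \<kappa>(2) by (simp add: mult.assoc[symmetric])
    finally show "(\<Sum>y\<in>F m. Q x y * W y) \<le> - c * v x" .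
  qed (use W_nonneg y0 F_E in auto)
  then show thesis
    using that W_le \<open>\<epsilon> > 0\<close> unfolding \<kappa>_def \<epsilon>_def by blast
qed

end

context hitting_comparison
begin

text \<open>
  The error equals \<open>- 2 G (\<mu> h)\<close> for the centred and normalized function \<open>h\<close> below, with \<open>G = p g\<close>.
  The factor \<open>2 G\<close> is what makes \<open>\<bar>h\<bar> \<le> c v\<close>: both \<open>g\<close> and the mean \<open>a\<close> are bounded by \<open>G c v\<close>.
\<close>
lemma weighted_error_bound:
  assumes irred: "irreducible_qmatrix E Q"
    and stat: "stationary_distribution E (lc_trunc n Q) \<mu>"
    and width: "\<And>m. m \<ge> n \<Longrightarrow> S m = S n"
    and g: "\<And>x. x \<in> E \<Longrightarrow> 1 \<le> g x \<and> g x \<le> c * v x"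
  shows "weighted E (\<lambda>x. \<bar>p x - \<mu> x\<bar>) g / weighted E p g
    \<le> ennreal (2 * (\<Sum>(i, j)\<in>{..S n} \<times> {..S (Suc n)}. \<mu> (n, i) * Q (n, i) (Suc n, j) * (W (n, j) + W (Suc n, j))))"
    (is "_ \<le> ennreal (2 * ?Z)")
proof -
  have \<mu>0: "0 \<le> \<mu> x" if "x \<in> E" for x using stat that by (simp add: stationary_distribution_def)
  have \<mu>_above: "\<mu> x = 0" if "x \<in> E - F n" for x
    using that lc_trunc_no_mass_above[OF irred stat, of x]
    by (cases x) (auto simp: levels_upto_def state_space_def)
  have \<mu>_has_sum: "((\<lambda>x. \<mu> x * u x) has_sum (\<Sum>x\<in>F n. \<mu> x * u x)) E" for u
  proof -
    have "((\<lambda>x. \<mu> x * u x) has_sum s) E \<longleftrightarrow> ((\<lambda>x. \<mu> x * u x) has_sum s) (F n)" for s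
      using \<mu>_above F_E by (intro has_sum_cong_neutral) auto
    then show ?thesis using finite_levels_upto by simp
  qed
  have \<mu>1: "(\<Sum>x\<in>F n. \<mu> x) = 1"
    using \<mu>_has_sum[of "\<lambda>_. 1"] stat has_sum_unique by (fastforce simp: stationary_distribution_def)
  have pv: "(\<lambda>x. p x * (c * v x)) summable_on E"
    using summable_on_cmult_right[OF p_v_summable, of c] by (simp add: mult.left_commute)
  have pg: "(\<lambda>x. p x * g x) summable_on E"
  proof (rule summable_on_comparison_test[OF pv])
    show "p x * g x \<le> p x * (c * v x)" "0 \<le> p x * g x" if "x \<in> E" for x
      using g[OF that] p_nonneg[OF that] by (auto intro: mult_left_mono mult_nonneg_nonneg)
  qed
  define G where "G = (\<Sum>\<^sub>\<infinity>x\<in>E. p x * g x)"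
  have pg_sum: "((\<lambda>x. p x * g x) has_sum G) E"
    unfolding G_def using pg by simp
  have "1 \<le> G"
    by (rule has_sum_mono[OF p_sum pg_sum]) (use g p_nonneg mult_left_mono[of 1] in fastforce)
  define h0 where "h0 = (\<lambda>x. sgn (p x - \<mu> x) * g x)"
  have h0_le: "\<bar>h0 x\<bar> \<le> g x" if "x \<in> E" for x
    using g[OF that] by (auto simp: h0_def abs_mult sgn_if)
  have ph0_abs: "(\<lambda>x. norm (p x * h0 x)) summable_on E"
  proof (rule summable_on_comparison_test[OF pg])
    show "norm (p x * h0 x) \<le> p x * g x" if "x \<in> E" for x
      using h0_le[OF that] p_nonneg[OF that] by (simp add: abs_mult mult_left_mono)
  qed simp
  define a where "a = (\<Sum>\<^sub>\<infinity>x\<in>E. p x * h0 x)"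
  have a: "((\<lambda>x. p x * h0 x) has_sum a) E"
    unfolding a_def using abs_summable_summable[OF ph0_abs] by simp
  have "\<bar>a\<bar> \<le> (\<Sum>\<^sub>\<infinity>x\<in>E. norm (p x * h0 x))"
    unfolding a_def using norm_infsum_bound[OF ph0_abs] by simp
  also have "\<dots> \<le> G"
    unfolding G_def using h0_le p_nonneg
    by (intro infsum_mono ph0_abs pg) (simp add: abs_mult mult_left_mono)
  finally have a_le: "\<bar>a\<bar> \<le> G" .
  define h where "h = (\<lambda>x. (h0 x - a) / (2 * G))"
  have h: "\<bar>h x\<bar> \<le> c * v x" if "x \<in> E" for x
  proof -
    have "\<bar>h0 x - a\<bar> \<le> g x + G" using h0_le[OF that] a_le by linarith
    also have "\<dots> \<le> G * (c * v x) + G * (c * v x)"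
      using g[OF that] \<open>1 \<le> G\<close> cv_ge_1[OF that] mult_right_mono[of 1 G "c * v x"] mult_left_mono[of 1 "c * v x" G]
      by (intro add_mono) linarith+
    finally show ?thesis using \<open>1 \<le> G\<close> by (simp add: h_def abs_divide field_simps)
  qed
  have "((\<lambda>x. (p x * h0 x - p x * a) * (1 / (2 * G))) has_sum (a - 1 * a) * (1 / (2 * G))) E"
    by (intro has_sum_cmult_left has_sum_diff a p_sum)
  then have ph: "((\<lambda>x. p x * h x) has_sum 0) E"
    by (simp add: h_def right_diff_distrib)
  have A0: "0 \<le> \<mu> (n, i) * Q (n, i) (Suc n, j)" if "i \<le> S n" "j \<le> S (Suc n)" for i j
    using that by (intro mult_nonneg_nonneg \<mu>0 off_diagonal) (auto simp: state_space_def)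
  have "\<bar>\<Sum>x\<in>F n. \<mu> x * h x\<bar>
    \<le> (\<Sum>q\<in>{..S n} \<times> {..S (Suc n)}. \<mu> (n, fst q) * Q (n, fst q) (Suc n, snd q) * (W (n, snd q) + W (Suc n, snd q)))"
  proof (rule flux_bound)
    show "(\<Sum>x\<in>F n. \<mu> x * h x) = \<alpha> * (\<Sum>x\<in>F n. \<mu> x * f x)
        - (\<Sum>q\<in>{..S n} \<times> {..S (Suc n)}. \<mu> (n, fst q) * Q (n, fst q) (Suc n, snd q) * (f (Suc n, snd q) - f (n, snd q)))"
      if "\<alpha> > 0" "\<And>x. x \<in> F n \<Longrightarrow> \<alpha> * f x - (\<Sum>y\<in>F (Suc n). Q x y * f y) = h x" for \<alpha> f
      using lc_trunc_flux[OF irred stat width that(2)] by (simp add: case_prod_beta)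
    show "0 \<le> \<mu> (n, fst q) * Q (n, fst q) (Suc n, snd q) \<and> (n, snd q) \<in> E \<and> (Suc n, snd q) \<in> E"
      if "q \<in> {..S n} \<times> {..S (Suc n)}" for q
      using that A0 width[of "Suc n"] by (auto simp: state_space_def)
  qed (use \<mu>0 F_E \<mu>1 h ph in auto)
  then have Z: "\<bar>\<Sum>x\<in>F n. \<mu> x * h x\<bar> \<le> ?Z" by (simp add: case_prod_beta)
  have "(\<Sum>x\<in>F n. \<mu> x * h x) = ((\<Sum>x\<in>F n. \<mu> x * h0 x) - (\<Sum>x\<in>F n. \<mu> x) * a) / (2 * G)"
    unfolding sum_distrib_right sum_subtractf[symmetric] sum_divide_distrib
    by (intro sum.cong refl) (simp add: h_def right_diff_distrib)
  then have "a - (\<Sum>x\<in>F n. \<mu> x * h0 x) = - (2 * G * (\<Sum>x\<in>F n. \<mu> x * h x))"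
    using \<open>1 \<le> G\<close> \<mu>1 by simp
  also have "\<dots> \<le> 2 * G * \<bar>\<Sum>x\<in>F n. \<mu> x * h x\<bar>"
    using \<open>1 \<le> G\<close> by (simp add: abs_if)
  also have "\<dots> \<le> 2 * G * ?Z"
    using Z \<open>1 \<le> G\<close> by (intro mult_left_mono) auto
  finally have err: "a - (\<Sum>x\<in>F n. \<mu> x * h0 x) \<le> 2 * G * ?Z" .
  have "((\<lambda>x. p x * h0 x - \<mu> x * h0 x) has_sum (a - (\<Sum>x\<in>F n. \<mu> x * h0 x))) E"
    by (intro has_sum_diff a \<mu>_has_sum)
  also have "(\<lambda>x. p x * h0 x - \<mu> x * h0 x) = (\<lambda>x. \<bar>p x - \<mu> x\<bar> * g x)"
    by (rule ext) (auto simp: h0_def sgn_if algebra_simps)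
  finally have diff: "((\<lambda>x. \<bar>p x - \<mu> x\<bar> * g x) has_sum (a - (\<Sum>x\<in>F n. \<mu> x * h0 x))) E" .
  have g0: "0 \<le> g x" if "x \<in> E" for x using g[OF that] by linarith
  have "weighted E (\<lambda>x. \<bar>p x - \<mu> x\<bar>) g = ennreal (a - (\<Sum>x\<in>F n. \<mu> x * h0 x))"
    using weighted_eq_ennreal_infsum[OF has_sum_imp_summable[OF diff]] g0 infsumI[OF diff] by simp
  moreover have "weighted E p g = ennreal G"
    using weighted_eq_ennreal_infsum[OF pg] g0 p_nonneg by (simp add: G_def)
  moreover have "0 \<le> a - (\<Sum>x\<in>F n. \<mu> x * h0 x)"
    by (rule has_sum_nonneg[OF diff]) (use g0 in auto)
  ultimately have "weighted E (\<lambda>x. \<bar>p x - \<mu> x\<bar>) g / weighted E p g = ennreal ((a - (\<Sum>x\<in>F n. \<mu> x * h0 x)) / G)"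
    using \<open>1 \<le> G\<close> by (simp add: divide_ennreal)
  also have "\<dots> \<le> ennreal (2 * ?Z)"
    using err \<open>1 \<le> G\<close> by (intro ennreal_leI) (simp add: field_simps)
  finally show ?thesis .
qed

end

theorem corollary4p1:
  fixes S :: "nat \<Rightarrow> nat"
    and M :: "state \<Rightarrow> 'w measure"
    and X :: "real \<Rightarrow> 'w \<Rightarrow> state"
    and Q :: "state \<Rightarrow> state \<Rightarrow> real"
    and A :: "nat \<Rightarrow> int \<Rightarrow> nat \<Rightarrow> nat \<Rightarrow> real"
    and p v :: "state \<Rightarrow> real"
    and pn :: "nat \<Rightarrow> state \<Rightarrow> real"
    and b c \<beta> :: real
    and K N :: nat
  assumes level_sizes: "\<And>k. k \<ge> 1 \<Longrightarrow> S k = S 1"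
    and chain: "regular_jump_chain (state_space S) M X"
    and ergodic: "ergodic_chain (state_space S) M X"
    and generator: "is_generator (state_space S) M X Q"
    and conservative: "conservative (state_space S) Q"
    and qbd: "ld_qbd S Q A"
    and stationary: "stationary_distribution (state_space S) Q p"
    and irreducible: "irreducible_qmatrix (state_space S) Q"
    and single_class: "\<And>n. n \<ge> 1 \<Longrightarrow>
          \<exists>!C. C \<in> communicating_classes (state_space S) (lc_trunc n Q) \<and> C \<subseteq> levels_upto S n"
    and "b > 0" and "c > 0"
    and v_ge: "\<And>x. x \<in> state_space S \<Longrightarrow> v x \<ge> 1 / c"
    and drift: "\<And>x. x \<in> state_space S \<Longrightarrow>
          (\<Sum>\<^sub>\<infinity>y\<in>state_space S. Q x y * v y) \<le> - c * v x + b * indicator (levels_upto S K) x"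
    and stationary_trunc: "\<And>n. n \<ge> 1 \<Longrightarrow>
          stationary_distribution (state_space S) (lc_trunc n Q) (pn n)"
    and "\<beta> > 0" and "N \<ge> K"
    and corner: "\<And>x y. x \<in> levels_upto S K \<Longrightarrow> y \<in> levels_upto S K \<Longrightarrow>
          0 < trunc_resolvent S Q \<beta> N x y
          \<and> trunc_resolvent S Q \<beta> N x y \<le> resolvent_kernel \<beta> (trans_prob M X) x y"
  shows "\<forall>n\<ge>1.
    (SUP g\<in>{g. \<forall>x\<in>state_space S. 1 \<le> g x \<and> g x \<le> c * v x}.
        weighted (state_space S) (\<lambda>x. \<bar>p x - pn n x\<bar>) g / weighted (state_space S) p g)
    \<le> ennreal (2 * (\<Sum>i\<le>S n. \<Sum>j\<le>S (n + 1). pn n (n, i) * A n 1 i j *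
          (v (n, j) + v (n + 1, j) + 2 * b * (1 / c + 2 / (\<beta> * phi_bar S Q \<beta> K N)))))"
proof -
  interpret skip_free_generator S Q
  proof
    show "0 \<le> Q x y" if xy: "x \<in> state_space S" "y \<in> state_space S" "x \<noteq> y" for x y
    proof (rule tendsto_lowerbound)
      show "((\<lambda>t. (trans_prob M X t x y - of_bool (x = y)) / t) \<longlongrightarrow> Q x y) (at_right 0)"
        using generator xy unfolding is_generator_def by blast
      show "\<forall>\<^sub>F t in at_right 0. 0 \<le> (trans_prob M X t x y - of_bool (x = y)) / t"
        using eventually_at_right_less[of 0]
        by eventually_elim (use xy(3) in \<open>simp add: trans_prob_def\<close>)
    qed simp
    show "Q x y = 0" if "x \<in> state_space S" "y \<in> state_space S" "fst x + 2 \<le> fst y" for x y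
      using qbd that by (cases x; cases y) (auto simp: ld_qbd_def state_space_def)
  qed (fact conservative)
  interpret drift_generator S Q p v b c K
    by unfold_locales (fact stationary | fact honest_resolvent[OF chain generator] | fact | fact v_ge | fact drift)+
  obtain W y0 where hc: "hitting_comparison S Q p v b c K W y0 N"
    and W_le: "\<And>x. x \<in> E \<Longrightarrow> W x \<le> v x + b / (\<beta> * phi_bar S Q \<beta> K N)"
    and \<epsilon>: "phi_bar S Q \<beta> K N > 0"
    using hitting_comparison_exists[OF \<open>\<beta> > 0\<close> \<open>N \<ge> K\<close>] corner by metis
  interpret hitting_comparison S Q p v b c K W y0 N by (rule hc)
  show ?thesis
  proof (intro allI impI SUP_least)
    fix n :: nat and g
    assume n: "1 \<le> n" and g: "g \<in> {g. \<forall>x\<in>state_space S. 1 \<le> g x \<and> g x \<le> c * v x}"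
    have width: "S m = S n" if "m \<ge> n" for m
      using level_sizes[of m] level_sizes[of n] that n by simp
    let ?C = "2 * b * (1 / c + 2 / (\<beta> * phi_bar S Q \<beta> K N))"
    have "weighted E (\<lambda>x. \<bar>p x - pn n x\<bar>) g / weighted E p g
      \<le> ennreal (2 * (\<Sum>(i, j)\<in>{..S n} \<times> {..S (Suc n)}. pn n (n, i) * Q (n, i) (Suc n, j) * (W (n, j) + W (Suc n, j))))"
      by (rule weighted_error_bound[OF irreducible stationary_trunc[OF n] width]) (use g in auto)
    also have "\<dots> \<le> ennreal (2 * (\<Sum>(i, j)\<in>{..S n} \<times> {..S (Suc n)}. pn n (n, i) * A n 1 i j *
        (v (n, j) + v (n + 1, j) + ?C)))"
    proof (intro ennreal_leI mult_left_mono sum_mono)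
      fix q assume "q \<in> {..S n} \<times> {..S (Suc n)}"
      then obtain i j where q: "q = (i, j)" and ij: "i \<le> S n" "j \<le> S (Suc n)" by auto
      have E: "(n, i) \<in> E" "(n, j) \<in> E" "(Suc n, j) \<in> E"
        using ij width[of "Suc n"] by (auto simp: state_space_def)
      have Q: "Q (n, i) (Suc n, j) = A n 1 i j" using qbd ij by (auto simp: ld_qbd_def)
      have "0 \<le> pn n (n, i)" using stationary_trunc[OF n] E by (simp add: stationary_distribution_def)
      moreover have "0 \<le> A n 1 i j" unfolding Q[symmetric] by (rule off_diagonal) (use E in auto)
      moreover have "b / (\<beta> * phi_bar S Q \<beta> K N) + b / (\<beta> * phi_bar S Q \<beta> K N) \<le> ?C"
        using \<open>b > 0\<close> \<open>c > 0\<close> \<open>\<beta> > 0\<close> \<epsilon> by (simp add: field_simps)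
      ultimately have "pn n (n, i) * Q (n, i) (Suc n, j) * (W (n, j) + W (Suc n, j))
          \<le> pn n (n, i) * A n 1 i j * (v (n, j) + v (n + 1, j) + ?C)"
        unfolding Q using W_le[OF E(2)] W_le[OF E(3)] by (intro mult_left_mono) auto
      then show "(case q of (i, j) \<Rightarrow> pn n (n, i) * Q (n, i) (Suc n, j) * (W (n, j) + W (Suc n, j)))
          \<le> (case q of (i, j) \<Rightarrow> pn n (n, i) * A n 1 i j * (v (n, j) + v (n + 1, j) + ?C))"
        unfolding q by (simp only: case_prod_conv)
    qed simp
    finally show "weighted (state_space S) (\<lambda>x. \<bar>p x - pn n x\<bar>) g / weighted (state_space S) p g
      \<le> ennreal (2 * (\<Sum>i\<le>S n. \<Sum>j\<le>S (n + 1). pn n (n, i) * A n 1 i j * (v (n, j) + v (n + 1, j) + ?C)))"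
      by (simp add: sum.cartesian_product)
  qed
qed

end
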